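(* For every integer $m\ge 0$, the following identities hold in $\mathbf U$: \[ t_{\mathrm{odd}}^{(2m)} = \sum_{c=0}^m \sum_{a=0}^{2m-2c} q^{\binom{2c-1}{2}-1 -a(2m-2c-a)} \check E^{(a)} \begin{Bmatrix} h;2-m\\ c\end{Bmatrix} F^{(2m-2c-a)} + \sum_{c=0}^{m-1} \sum_{a=0}^{2m-1-2c} q^{\binom{2c}{2}+1-2m -a(2m-1-2c-a)} \check E^{(a)} \begin{Bmatrix} h;2-m\\ c\end{Bmatrix} K^{-1} F^{(2m-1-2c-a)}, \] \[ t_{\mathrm{odd}}^{(2m+1)} = \sum_{c=0}^{m} \sum_{a=0}^{2m+1-2c} q^{\binom{2c}{2} -a(2m+1-2c-a)} \check E^{(a)} \begin{Bmatrix} h;1-m\\ c\end{Bmatrix} F^{(2m+1-2c-a)} +\sum_{c=0}^{m} \sum_{a=0}^{2m-2c} q^{\binom{2c+1}{2}-2m -a(2m-2c-a)} \check E^{(a)} \begin{Bmatrix} h;1-m\\ c\end{Bmatrix} K^{-1} F^{(2m-2c-a)}. \]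
   Context: $\mathbf U=\mathbf U_q(\mathfrak{sl}_2)$ is the $\mathbb Q(q)$-algebra generated by $E,F,K,K^{-1}$ with relations $KK^{-1}=K^{-1}K=1$, $EF-FE=\frac{K-K^{-1}}{q-q^{-1}}$, $KE=q^2EK$, $KF=q^{-2}FK$. For $n\in\mathbb Z$, $[n]=\frac{q^n-q^{-n}}{q-q^{-1}}$, and $[n]!=[1][2]\cdots[n]$ for $n\ge 0$ (with $[0]!=1$). Put $\check E=q^{-1}EK^{-1}$, $t=\check E+F+K^{-1}$, and $\check E^{(n)}=\check E^n/[n]!$, $F^{(n)}=F^n/[n]!$ for $n\ge 0$. (The symbol $h$ stands for $h=\frac{K^{-2}-1}{q^2-1}$.) For $a\in\mathbb Z$, $n\ge 0$, \[ \begin{Bmatrix} h;a\\ n\end{Bmatrix}=\prod_{i=1}^n\frac{q^{4a+4i-4}K^{-2}-q^2}{q^{4i}-1} \] (equal to $1$ for $n=0$). In exponents, $\binom{x}{2}=x(x-1)/2$ for all integers $x$ (in particular $\binom{-1}{2}=1$). Empty sums are $0$. The $\imath$-divided powers $t_{\mathrm{odd}}^{(n)}$ are the polynomials in $t$ determined by $t_{\mathrm{odd}}^{(0)}=1$, $t_{\mathrm{odd}}^{(1)}=t$, and, for $a\ge 1$: $t\cdot t_{\mathrm{odd}}^{(2a-1)}=[2a]\,t_{\mathrm{odd}}^{(2a)}$, $t\cdot t_{\mathrm{odd}}^{(2a)}=[2a+1]\,t_{\mathrm{odd}}^{(2a+1)}+[2a]\,t_{\mathrm{odd}}^{(2a-1)}$.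 Equivalently, $t_{\mathrm{odd}}^{(2a)}=\frac{1}{[2a]!}\,t\prod_{i=1-a}^{a-1}(t-[2i])$ for $a\ge1$ and $t_{\mathrm{odd}}^{(2a+1)}=\frac{1}{[2a+1]!}\prod_{i=-a}^{a}(t-[2i])$ for $a\ge 0$. *)

theory Defs
  imports
    "HOL-Library.Poly_Mapping"
    "HOL-Computational_Algebra.Computational_Algebra"
begin

type_synonym ratfun = "rat poly fract"

definition q :: ratfun where
  "q = Fract [:0, 1:] 1"

definition qint :: "int \<Rightarrow> ratfun" where
  "qint n = (q powi n - q powi (- n)) / (q - inverse q)"

definition qfact :: "nat \<Rightarrow> ratfun" where
  "qfact n = (\<Prod>i = 1..n. qint (int i))"

lemma q_power: "q ^ n = Fract (monom 1 n) 1"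
  by (induction n) (simp_all add: q_def One_fract_def monom_Suc monom_0 flip: one_pCons)

lemma q_nonzero: "q \<noteq> 0"
  by (simp add: q_def Zero_fract_def eq_fract)

lemma q_power_eq_1_iff: "q ^ n = 1 \<longleftrightarrow> n = 0"
proof -
  have "q ^ n = 1 \<longleftrightarrow> monom (1 :: rat) n = 1"
    by (simp add: q_power One_fract_def eq_fract)
  also have "\<dots> \<longleftrightarrow> n = 0"
    by (metis degree_1 degree_monom_eq monom_0 one_neq_zero one_pCons)
  finally show ?thesis .
qed

lemma qint_nonzero:
  assumes "n > 0"
  shows "qint (int n) \<noteq> 0"
proof -
  have nz: "q ^ k \<noteq> inverse (q ^ k)" if "k > 0" for k
  proof
    assume "q ^ k = inverse (q ^ k)"
    then have "q ^ k * q ^ k = 1"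
      by (metis q_nonzero power_not_zero right_inverse)
    then have "q ^ (k + k) = 1"
      by (simp add: power_add)
    with that show False
      by (simp add: q_power_eq_1_iff)
  qed
  from nz[of n] nz[of 1] assms show ?thesis
    by (simp add: qint_def power_int_minus)
qed

datatype gen = GenE | GenF | GenK | GenKinv

text \<open>Words under concatenation, written additively because \<^typ>\<open>'a \<Rightarrow>\<^sub>0 'b\<close> is
  the monoid algebra of an additive (here non-commutative) monoid.\<close>

datatype word = Word (letters: "gen list")

instantiation word :: monoid_add
begin

definition zero_word :: word where
  "0 = Word []"

definition plus_word :: "word \<Rightarrow> word \<Rightarrow> word" where
  "v + w = Word (letters v @ letters w)"

instance
  by standard (simp_all add: zero_word_def plus_word_def)

end

type_synonym free_alg = "word \<Rightarrow>\<^sub>0 ratfun"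

definition free_gen :: "gen \<Rightarrow> free_alg" where
  "free_gen g = Poly_Mapping.single (Word [g]) 1"

definition free_const :: "ratfun \<Rightarrow> free_alg" where
  "free_const c = Poly_Mapping.single 0 c"

lemma free_const_add: "free_const (c + d) = free_const c + free_const d"
  by (simp add: free_const_def single_add)

lemma free_const_mult: "free_const (c * d) = free_const c * free_const d"
  by (simp add: free_const_def mult_single)

lemma free_const_1: "free_const 1 = 1"
  by (simp add: free_const_def)

lemma free_alg_induct [case_names zero add]:
  fixes x :: free_alg
  assumes "P 0" and "\<And>x w c. P x \<Longrightarrow> P (Poly_Mapping.single w c + x)"
  shows "P x"
proof (induction x rule: update_induct)
  case const
  from assms(1) show ?case .
next
  case (update f a b)
  have "Poly_Mapping.update a b f = Poly_Mapping.single a b + f"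
    using update(1)
    by (intro poly_mapping_eqI)
       (auto simp: lookup_update lookup_add lookup_single when_def in_keys_iff)
  with assms(2)[OF update(3)] show ?case by simp
qed

lemma free_const_central: "free_const c * x = x * free_const c"
  by (induction x rule: free_alg_induct)
     (simp_all add: free_const_def mult_single distrib_left distrib_right mult.commute)

definition relators :: "free_alg set" where
  "relators =
    {free_gen GenK * free_gen GenKinv - 1,
     free_gen GenKinv * free_gen GenK - 1,
     free_gen GenE * free_gen GenF - free_gen GenF * free_gen GenE
       - free_const (1 / (q - inverse q)) * (free_gen GenK - free_gen GenKinv),
     free_gen GenK * free_gen GenE - free_const (q\<^sup>2) * free_gen GenE * free_gen GenK,
     free_gen GenK * free_gen GenF
       - free_const (q powi (- 2)) * free_gen GenF * free_gen GenK}"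

text \<open>The two-sided ideal generated by the relators; it is closed under negation since
  \<^term>\<open>- (a * r * b) = (- a) * r * b\<close>.\<close>

inductive_set rel_ideal :: "free_alg set" where
  zero: "0 \<in> rel_ideal"
| step: "r \<in> relators \<Longrightarrow> x \<in> rel_ideal \<Longrightarrow> a * r * b + x \<in> rel_ideal"

lemma rel_ideal_add:
  assumes "x \<in> rel_ideal" "y \<in> rel_ideal"
  shows "x + y \<in> rel_ideal"
  using assms by (induction) (simp_all add: add.assoc rel_ideal.step)

lemma rel_ideal_mult:
  assumes "x \<in> rel_ideal"
  shows "a * x * b \<in> rel_ideal"
  using assms
proof induction
  case zero
  then show ?case by (simp add: rel_ideal.zero)
next
  case (step r x c d)
  have "a * (c * r * d + x) * b = (a * c) * r * (d * b) + a * x * b"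
    by (simp add: distrib_left distrib_right mult.assoc)
  with step show ?case by (metis rel_ideal.step)
qed

lemma rel_ideal_mult_left: "x \<in> rel_ideal \<Longrightarrow> a * x \<in> rel_ideal"
  using rel_ideal_mult[of x a 1] by simp

lemma rel_ideal_mult_right: "x \<in> rel_ideal \<Longrightarrow> x * b \<in> rel_ideal"
  using rel_ideal_mult[of x 1 b] by simp

lemma rel_ideal_minus: "x \<in> rel_ideal \<Longrightarrow> - x \<in> rel_ideal"
  using rel_ideal_mult_left[of x "- 1"] by simp

lemma relators_in_ideal: "r \<in> relators \<Longrightarrow> r \<in> rel_ideal"
  using rel_ideal.step[of r 0 1 1] by (simp add: rel_ideal.zero)

text \<open>The trivial character (\<open>E, F \<mapsto> 0\<close> and \<open>K, K\<inverse> \<mapsto> 1\<close>) shows that the ideal is proper;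
  this is needed because \<^class>\<open>ring_1\<close> demands \<^prop>\<open>0 \<noteq> 1\<close>.\<close>

definition word_char :: "word \<Rightarrow> ratfun" where
  "word_char w = (if set (letters w) \<subseteq> {GenK, GenKinv} then 1 else 0)"

definition counit :: "free_alg \<Rightarrow> ratfun" where
  "counit x = (\<Sum>w\<in>Poly_Mapping.keys x. Poly_Mapping.lookup x w * word_char w)"

lemma counit_superset:
  assumes "finite A" "Poly_Mapping.keys x \<subseteq> A"
  shows "counit x = (\<Sum>w\<in>A. Poly_Mapping.lookup x w * word_char w)"
  unfolding counit_def using assms
  by (intro sum.mono_neutral_left) (auto simp: in_keys_iff)

lemma counit_0: "counit 0 = 0"
  by (simp add: counit_def)

lemma counit_add: "counit (x + y) = counit x + counit y"
proof -
  let ?A = "Poly_Mapping.keys x \<union> Poly_Mapping.keys y"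
  have "counit (x + y) = (\<Sum>w\<in>?A. Poly_Mapping.lookup (x + y) w * word_char w)"
    by (intro counit_superset) (simp_all add: keys_add)
  also have "\<dots> = (\<Sum>w\<in>?A. Poly_Mapping.lookup x w * word_char w)
      + (\<Sum>w\<in>?A. Poly_Mapping.lookup y w * word_char w)"
    by (simp add: lookup_add distrib_right sum.distrib)
  also have "\<dots> = counit x + counit y"
    by (simp add: counit_superset[of ?A x] counit_superset[of ?A y])
  finally show ?thesis .
qed

lemma counit_single: "counit (Poly_Mapping.single w c) = c * word_char w"
  by (simp add: counit_def)

lemma word_char_add: "word_char (v + w) = word_char v * word_char w"
  by (simp add: word_char_def plus_word_def)

lemma counit_single_mult:
  "counit (Poly_Mapping.single v c * y) = c * word_char v * counit y"
  by (induction y rule: free_alg_induct)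
     (simp_all add: counit_0 counit_add distrib_left mult_single counit_single
        word_char_add mult_ac)

lemma counit_mult: "counit (x * y) = counit x * counit y"
  by (induction x rule: free_alg_induct)
     (simp_all add: counit_0 counit_add distrib_right counit_single_mult counit_single)

lemma counit_diff: "counit (x - y) = counit x - counit y"
  using counit_add[of "x - y" y] by simp

lemma counit_1: "counit 1 = 1"
  by (simp add: counit_single word_char_def zero_word_def flip: single_one)

lemma counit_relators: "r \<in> relators \<Longrightarrow> counit r = 0"
  by (auto simp: relators_def counit_diff counit_mult counit_1 free_gen_def counit_single
      word_char_def)

lemma counit_rel_ideal: "x \<in> rel_ideal \<Longrightarrow> counit x = 0"
  by (induction rule: rel_ideal.induct) (simp_all add: counit_0 counit_add counit_mult counit_relators)

definition rel_eq :: "free_alg \<Rightarrow> free_alg \<Rightarrow> bool" where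
  "rel_eq x y \<longleftrightarrow> x - y \<in> rel_ideal"

lemma equivp_rel_eq: "equivp rel_eq"
proof (rule equivpI)
  show "reflp rel_eq"
    by (rule reflpI) (simp add: rel_eq_def rel_ideal.zero)
  show "symp rel_eq"
    by (rule sympI) (use rel_ideal_minus in \<open>fastforce simp: rel_eq_def\<close>)
  show "transp rel_eq"
    proof (rule transpI)
    fix x y z
    assume "rel_eq x y" "rel_eq y z"
    then have "(x - y) + (y - z) \<in> rel_ideal"
      by (simp only: rel_eq_def rel_ideal_add)
    then show "rel_eq x z"
      by (simp add: rel_eq_def)
  qed
qed

quotient_type uqsl2 = free_alg / rel_eq
  by (rule equivp_rel_eq)

instantiation uqsl2 :: ring_1
begin

lift_definition zero_uqsl2 :: uqsl2 is 0 .

lift_definition one_uqsl2 :: uqsl2 is 1 .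

lift_definition plus_uqsl2 :: "uqsl2 \<Rightarrow> uqsl2 \<Rightarrow> uqsl2" is "(+)"
  unfolding rel_eq_def by (metis rel_ideal_add add_diff_add)

lift_definition uminus_uqsl2 :: "uqsl2 \<Rightarrow> uqsl2" is uminus
  unfolding rel_eq_def by (metis rel_ideal_minus minus_diff_minus)

lift_definition minus_uqsl2 :: "uqsl2 \<Rightarrow> uqsl2 \<Rightarrow> uqsl2" is "(-)"
proof -
  fix x x' y y' :: free_alg
  assume "rel_eq x x'" "rel_eq y y'"
  then have "(x - x') + - (y - y') \<in> rel_ideal"
    by (simp only: rel_eq_def rel_ideal_add rel_ideal_minus)
  then show "rel_eq (x - y) (x' - y')"
    by (simp add: rel_eq_def algebra_simps)
qed

lift_definition times_uqsl2 :: "uqsl2 \<Rightarrow> uqsl2 \<Rightarrow> uqsl2" is "(*)"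
proof -
  fix x x' y y' :: free_alg
  assume "rel_eq x x'" "rel_eq y y'"
  then have "(x - x') * y + x' * (y - y') \<in> rel_ideal"
    by (simp only: rel_eq_def rel_ideal_add rel_ideal_mult_left rel_ideal_mult_right)
  then show "rel_eq (x * y) (x' * y')"
    by (simp add: rel_eq_def algebra_simps)
qed

instance
proof
  show "(0 :: uqsl2) \<noteq> 1"
  proof transfer
    have "counit (0 - 1) \<noteq> 0"
      by (simp add: counit_diff counit_0 counit_1 del: diff_0)
    then show "\<not> rel_eq 0 1"
      using counit_rel_ideal unfolding rel_eq_def by blast
  qed
qed (transfer, simp add: rel_eq_def rel_ideal.zero algebra_simps)+

end

lift_definition EE :: uqsl2 is "free_gen GenE" .
lift_definition FF :: uqsl2 is "free_gen GenF" .
lift_definition KK :: uqsl2 is "free_gen GenK" .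
lift_definition Kinv :: uqsl2 is "free_gen GenKinv" .

lift_definition const :: "ratfun \<Rightarrow> uqsl2" is free_const .

definition smult_uq :: "ratfun \<Rightarrow> uqsl2 \<Rightarrow> uqsl2"  (infixr \<open>\<cdot>\<close> 75) where
  "c \<cdot> x = const c * x"

lemma const_add: "const (c + d) = const c + const d"
  by transfer (simp add: free_const_add rel_eq_def rel_ideal.zero)

lemma const_mult: "const (c * d) = const c * const d"
  by transfer (simp add: free_const_mult rel_eq_def rel_ideal.zero)

lemma const_1: "const 1 = 1"
  by transfer (simp add: free_const_1 rel_eq_def rel_ideal.zero)

lemma const_central: "const c * x = x * const c"
  by transfer (simp add: free_const_central rel_eq_def rel_ideal.zero)

lemma KK_Kinv: "KK * Kinv = 1"
  by transfer (simp add: rel_eq_def relators_in_ideal relators_def)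

lemma Kinv_KK: "Kinv * KK = 1"
  by transfer (simp add: rel_eq_def relators_in_ideal relators_def)

lemma EE_FF: "EE * FF - FF * EE = (1 / (q - inverse q)) \<cdot> (KK - Kinv)"
  unfolding smult_uq_def
  by transfer (unfold rel_eq_def, rule relators_in_ideal, simp add: relators_def)

lemma KK_EE: "KK * EE = q\<^sup>2 \<cdot> EE * KK"
  unfolding smult_uq_def mult.assoc[symmetric]
  by transfer (unfold rel_eq_def, rule relators_in_ideal, simp add: relators_def)

lemma KK_FF: "KK * FF = q powi (- 2) \<cdot> FF * KK"
  unfolding smult_uq_def mult.assoc[symmetric]
  by transfer (unfold rel_eq_def, rule relators_in_ideal, simp add: relators_def)

definition Echeck :: uqsl2 where
  "Echeck = inverse q \<cdot> (EE * Kinv)"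

definition tt :: uqsl2 where
  "tt = Echeck + FF + Kinv"

definition Echeck_dp :: "nat \<Rightarrow> uqsl2" where
  "Echeck_dp n = (1 / qfact n) \<cdot> Echeck ^ n"

definition FF_dp :: "nat \<Rightarrow> uqsl2" where
  "FF_dp n = (1 / qfact n) \<cdot> FF ^ n"

text \<open>The factors of the braces symbol commute with each other, so the order of the
  product is immaterial; a list product is used since \<^typ>\<open>uqsl2\<close> is not commutative.\<close>

definition h_brace :: "int \<Rightarrow> nat \<Rightarrow> uqsl2" where
  "h_brace a n = prod_list (map (\<lambda>i.
     (1 / (q ^ (4 * i) - 1)) \<cdot>
       (q powi (4 * a + 4 * int i - 4) \<cdot> Kinv\<^sup>2 - const (q\<^sup>2))) [1..<n + 1])"

text \<open>The generalised binomial coefficient \<open>x(x-1)/2\<close> for any integer \<open>x\<close>; the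
  division is exact.\<close>

definition choose2 :: "int \<Rightarrow> int" where
  "choose2 x = x * (x - 1) div 2"

text \<open>The two-step recurrence solved for its leading term, which is possible because quantum
  integers \<open>[n]\<close>, \<open>n > 0\<close>, are nonzero (\<open>qint_nonzero\<close>). The unsolved form is
  \<open>t_odd_even_rec\<close>, \<open>t_odd_odd_rec\<close>.\<close>

fun t_odd :: "nat \<Rightarrow> uqsl2" where
  "t_odd 0 = 1"
| "t_odd (Suc 0) = tt"
| "t_odd (Suc (Suc n)) =
     (1 / qint (int (n + 2))) \<cdot>
       (if even n then tt * t_odd (n + 1)
        else tt * t_odd (n + 1) - qint (int (n + 1)) \<cdot> t_odd n)"

lemma qint_cancel: "n > 0 \<Longrightarrow> qint (int n) \<cdot> (1 / qint (int n)) \<cdot> x = x"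
  by (simp add: smult_uq_def qint_nonzero const_1 flip: mult.assoc const_mult)

lemma t_odd_even_rec:
  assumes "a \<ge> 1"
  shows "tt * t_odd (2 * a - 1) = qint (2 * int a) \<cdot> t_odd (2 * a)"
proof -
  obtain b where b: "a = Suc b"
    using assms by (cases a) auto
  show ?thesis
    using qint_cancel[of "2 * b + 2"] by (simp add: b algebra_simps)
qed

lemma t_odd_odd_rec:
  assumes "a \<ge> 1"
  shows "tt * t_odd (2 * a) =
    qint (2 * int a + 1) \<cdot> t_odd (2 * a + 1) + qint (2 * int a) \<cdot> t_odd (2 * a - 1)"
proof -
  obtain b where b: "a = Suc b"
    using assms by (cases a) auto
  have "t_odd (2 * a + 1) = (1 / qint (int (2 * b + 3))) \<cdot>
      (tt * t_odd (2 * a) - qint (int (2 * b + 2)) \<cdot> t_odd (2 * b + 1))"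
    using t_odd.simps(3)[of "2 * b + 1"] by (simp add: b numeral_3_eq_3 del: t_odd.simps)
  then have "qint (int (2 * b + 3)) \<cdot> t_odd (2 * a + 1) =
      tt * t_odd (2 * a) - qint (int (2 * b + 2)) \<cdot> t_odd (2 * b + 1)"
    by (simp only: qint_cancel)
  then show ?thesis
    by (simp add: b algebra_simps del: t_odd.simps)
qed

end

theory Submission
  imports Defs
begin

text \<open>Write \<open>E'\<close> for \<^const>\<open>Echeck\<close>. Every term on the right-hand side of either expansion has the
triangular form
\<open>E'\<^bsup>(a)\<^esup> p(K\<inverse>) F\<^bsup>(b)\<^esup>\<close> with \<open>p\<close> a polynomial over the field
of rational functions in \<open>q\<close>.
Left multiplication by \<open>t = E' + F + K\<inverse>\<close> preserves the span of such terms: \<open>E'\<close> raises \<open>a\<close>,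
\<open>K\<inverse>\<close> multiplies \<open>p\<close> by its variable, and \<open>F\<close> commutes with \<open>E'\<^bsup>(a)\<^esup>\<close> up to a quadratic
polynomial in \<open>K\<inverse>\<close> and with \<open>p(K\<inverse>)\<close> up to the substitution \<open>x \<mapsto> q\<^bsup>-2\<^esup> x\<close> (lemma
\<open>tt_normal_term\<close>).
The whole theorem therefore reduces to commutative algebra: the proposed coefficients have to
satisfy the recurrence that \<open>t \<cdot> t_odd n = [n+1] t_odd (n+1) + (n even) [n] t_odd (n-1)\<close> imposes on
them.

The coefficient at \<open>(a, b)\<close> in \<open>t_odd n\<close> is \<open>q\<^bsup>-ab\<^esup> P(n,d)\<close>, where \<open>P(n,d)\<close> depends on \<open>a\<close> and \<open>b\<close> only through the deficit \<open>d = n - a - b\<close>; the two double sums of an expansion collect the even deficits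
\<open>2c\<close> and the odd deficits \<open>2c + 1\<close>.
The recurrence for \<open>P\<close> (lemma \<open>t_coeff_recurrence\<close>) involves three consecutive deficits. All
the brace polynomials that occur share the factor \<open>{h; s; k}\<close>, with \<open>d = 2k + 2\<close> or \<open>2k + 3\<close>,
and differ from it by at most one linear factor in \<open>K\<^bsup>-2\<^esup>\<close>. Once this common factor is cancelled, what
remains is a rational identity in \<open>q\<close>, \<open>q\<^sup>a\<close>, \<open>q\<^sup>b\<close>, \<open>q\<^sup>k\<close> and the variable: \<open>m\<close> is eliminated by
\<open>a + b + d = n + 1\<close>. The parities of \<open>n\<close> and \<open>d\<close> give four such identities, verified by expansion
as identities of Laurent polynomials.\<close>

section \<open>Polynomials in the inverse of K\<close>

interpretation uq: module smult_uq
  by standard (simp_all add: smult_uq_def const_add const_mult const_1 algebra_simps)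

lemma smult_uq_mult_left: "(c \<cdot> x) * y = c \<cdot> (x * y)"
  by (simp add: smult_uq_def mult.assoc)

lemma smult_uq_mult_right: "x * (c \<cdot> y) = c \<cdot> (x * y)"
  by (metis smult_uq_def mult.assoc const_central)

lemma const_0: "const 0 = 0"
  using const_add[of 0 0] by simp

lemmas ratfun_mult_ac = mult_ac[where 'a = ratfun]

text \<open>Horner evaluation at \<open>K\<inverse>\<close>. It differs from \<^const>\<open>poly\<close> in that the coefficients and the
point live in different rings, the second of which is not commutative.\<close>
definition at_Kinv :: "ratfun poly \<Rightarrow> uqsl2" where
  "at_Kinv p = fold_coeffs (\<lambda>c u. const c + Kinv * u) p 0"

lemma at_Kinv_0 [simp]: "at_Kinv 0 = 0"
  by (simp add: at_Kinv_def)

lemma at_Kinv_pCons [simp]: "at_Kinv (pCons c p) = const c + Kinv * at_Kinv p"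
  by (cases "c = 0 \<and> p = 0") (auto simp: at_Kinv_def const_0)

lemma at_Kinv_add: "at_Kinv (p + r) = at_Kinv p + at_Kinv r"
  by (induction p r rule: poly_induct2) (simp_all add: const_add algebra_simps)

lemma at_Kinv_smult: "at_Kinv (smult c p) = c \<cdot> at_Kinv p"
  by (induction p) (simp_all add: const_mult uq.scale_right_distrib smult_uq_mult_right, simp add: smult_uq_def)

text \<open>Although the quantum group is not commutative, \<open>K\<inverse>\<close> generates a commutative subalgebra because
scalars are central. Multiplicativity is what lets identities between polynomials over a field be
transported into the quantum group.\<close>
lemma at_Kinv_mult: "at_Kinv (p * r) = at_Kinv p * at_Kinv r"
  by (induction p) (simp_all add: at_Kinv_add at_Kinv_smult const_0 distrib_right mult.assoc, simp add: smult_uq_def)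

lemma at_Kinv_diff: "at_Kinv (p - r) = at_Kinv p - at_Kinv r"
  using at_Kinv_add[of "p - r" r] by (simp add: algebra_simps)

lemma at_Kinv_1 [simp]: "at_Kinv 1 = 1"
  by (simp add: const_1 one_pCons)

lemma at_Kinv_X: "at_Kinv [:0, 1:] = Kinv"
  by (simp add: const_0 const_1)

lemma at_Kinv_const: "at_Kinv [:c:] = const c"
  by simp

text \<open>The substitution \<open>x \<mapsto> q\<^bsup>-2\<^esup> x\<close>: the automorphism of polynomials in \<open>K\<inverse>\<close> effected by moving
\<open>F\<close> or \<^const>\<open>Echeck\<close> past them.\<close>
definition q_shift :: "ratfun poly \<Rightarrow> ratfun poly" where
  "q_shift p = pcompose p [:0, inverse (q\<^sup>2):]"

lemma q_shift_0 [simp]: "q_shift 0 = 0" by (simp add: q_shift_def)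

lemma q_shift_pCons: "q_shift (pCons c p) = [:c:] + [:0, inverse (q\<^sup>2):] * q_shift p"
  by (simp add: q_shift_def pcompose_pCons)

lemma poly_q_shift: "poly (q_shift p) y = poly p (y / q\<^sup>2)"
  by (simp add: q_shift_def poly_pcompose field_simps)

section \<open>Commutation relations\<close>

text \<open>The defining relations are stated for \<open>K\<close>, whereas everything below involves only \<open>K\<inverse>\<close>.\<close>
lemma Kinv_conj:
  assumes "KK * x = c \<cdot> (x * KK)" "c \<noteq> 0"
  shows "Kinv * x = inverse c \<cdot> (x * Kinv)"
proof -
  have "x * Kinv = Kinv * (KK * x) * Kinv"
    by (simp add: Kinv_KK flip: mult.assoc)
  also have "\<dots> = c \<cdot> (Kinv * x)"
    by (simp add: assms(1) smult_uq_mult_left smult_uq_mult_right mult.assoc KK_Kinv)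
  finally show ?thesis using assms(2) by simp
qed

lemma Kinv_FF: "Kinv * FF = q\<^sup>2 \<cdot> (FF * Kinv)"
  using Kinv_conj[of FF "q powi (-2)"] KK_FF q_nonzero
  by (simp add: smult_uq_mult_left power_int_minus)

lemma Kinv_EE: "Kinv * EE = inverse (q\<^sup>2) \<cdot> (EE * Kinv)"
  using Kinv_conj[of EE "q\<^sup>2"] KK_EE q_nonzero
  by (simp add: smult_uq_mult_left)

lemma FF_Kinv: "FF * Kinv = inverse (q\<^sup>2) \<cdot> (Kinv * FF)"
  using Kinv_FF q_nonzero by simp

lemma Kinv_Echeck: "Kinv * Echeck = inverse (q\<^sup>2) \<cdot> (Echeck * Kinv)"
  by (simp add: Echeck_def smult_uq_mult_left smult_uq_mult_right Kinv_EE mult.commute flip: mult.assoc)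

lemma q_minus_inverse: "q - inverse q \<noteq> 0"
  using qint_nonzero[of 1] by (auto simp: qint_def)

lemma q_sq: "q\<^sup>2 - 1 \<noteq> 0"
  using q_power_eq_1_iff[of 2] by simp

lemma q_minus_inverse_eq: "q - inverse q = (q\<^sup>2 - 1) / q"
  using q_nonzero by (simp add: field_simps power2_eq_square)

text \<open>The factor \<open>q\<inverse> K\<inverse>\<close> in \<^const>\<open>Echeck\<close> turns the commutator of \<open>E\<close> and \<open>F\<close> into a
\<open>q\<close>-commutator whose value \<open>h\<close> involves only \<open>K\<inverse>\<close>, never \<open>K\<close>; this is why polynomials in
\<open>K\<inverse>\<close> suffice as middle factors.\<close>
lemma FF_Echeck:
  "FF * Echeck = inverse (q\<^sup>2) \<cdot> (Echeck * FF) + (1 / (q\<^sup>2 - 1)) \<cdot> (Kinv\<^sup>2 - 1)"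
proof -
  have FE: "FF * EE = EE * FF - (1 / (q - inverse q)) \<cdot> (KK - Kinv)"
    using EE_FF by (simp add: algebra_simps)
  have eF: "inverse (q\<^sup>2) \<cdot> (Echeck * FF) = inverse q \<cdot> (EE * FF * Kinv)"
  proof -
    have "inverse (q\<^sup>2) * (inverse q * q\<^sup>2) = inverse q"
      using q_nonzero by (simp add: field_simps)
    note c2 = this
    show ?thesis
      by (simp add: Echeck_def smult_uq_mult_left smult_uq_mult_right Kinv_FF mult.assoc c2)
  qed
  have c: "inverse q * (1 / (q - inverse q)) = 1 / (q\<^sup>2 - 1)"
    using q_nonzero q_minus_inverse q_sq by (simp add: field_simps power2_eq_square)
  have "FF * Echeck = inverse q \<cdot> ((FF * EE) * Kinv)"
    by (simp add: Echeck_def smult_uq_mult_right mult.assoc)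
  also have "\<dots> = inverse q \<cdot> (EE * FF * Kinv) - (inverse q * (1 / (q - inverse q))) \<cdot> (1 - Kinv\<^sup>2)"
    unfolding FE
    by (simp add: left_diff_distrib smult_uq_mult_left uq.scale_right_diff_distrib KK_Kinv power2_eq_square)
  finally show ?thesis
    unfolding c eF by (simp add: uq.scale_right_diff_distrib)
qed

lemma at_Kinv_Echeck: "at_Kinv p * Echeck = Echeck * at_Kinv (q_shift p)"
proof (induction p)
  case (pCons a p)
  have "at_Kinv (pCons a p) * Echeck = const a * Echeck + Kinv * (at_Kinv p * Echeck)"
    by (simp add: distrib_right mult.assoc)
  also have "\<dots> = Echeck * const a + (Kinv * Echeck) * at_Kinv (q_shift p)"
    by (simp add: pCons.IH const_central mult.assoc)
  also have "\<dots> = Echeck * at_Kinv (q_shift (pCons a p))"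
    by (simp add: q_shift_pCons at_Kinv_add at_Kinv_smult const_0 distrib_left Kinv_Echeck
        smult_uq_mult_left smult_uq_mult_right mult.assoc)
  finally show ?case .
qed simp

lemma FF_at_Kinv: "FF * at_Kinv p = at_Kinv (q_shift p) * FF"
proof (induction p)
  case (pCons a p)
  have "FF * at_Kinv (pCons a p) = FF * const a + (FF * Kinv) * at_Kinv p"
    by (simp add: distrib_left mult.assoc)
  also have "\<dots> = const a * FF + inverse (q\<^sup>2) \<cdot> (Kinv * at_Kinv (q_shift p) * FF)"
    by (simp add: FF_Kinv pCons.IH const_central mult.assoc smult_uq_mult_left)
  also have "\<dots> = at_Kinv (q_shift (pCons a p)) * FF"
    by (simp add: q_shift_pCons at_Kinv_add at_Kinv_smult const_0 distrib_right
        smult_uq_mult_left smult_uq_mult_right mult.assoc)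
  finally show ?case .
qed simp

lemma Kinv_Echeck_power: "Kinv * Echeck ^ a = inverse (q ^ (2 * a)) \<cdot> (Echeck ^ a * Kinv)"
proof (induction a)
  case (Suc a)
  have "Kinv * Echeck ^ Suc a = (Kinv * Echeck) * Echeck ^ a"
    by (simp add: mult.assoc)
  also have "\<dots> = inverse (q ^ (2 * Suc a)) \<cdot> (Echeck ^ Suc a * Kinv)"
    by (simp add: Kinv_Echeck smult_uq_mult_left smult_uq_mult_right mult.assoc Suc.IH
        power2_eq_square ratfun_mult_ac)
  finally show ?case .
qed simp

text \<open>The polynomial in \<open>K\<inverse>\<close> by which \<open>E'\<^bsup>(a-1)\<^esup>\<close> is multiplied on the right when \<open>F\<close> is moved to the right past \<open>E'\<^bsup>(a)\<^esup>\<close>. The value at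
\<open>a = 1\<close> is \<open>h\<close>.\<close>
definition FE_correction :: "nat \<Rightarrow> ratfun poly" where
  "FE_correction a =
     smult (1 / (q\<^sup>2 - 1)) (smult (q powi (3 - 3 * int a)) ([:0, 1:]\<^sup>2) - [:q powi (1 - int a):])"

lemma poly_FE_correction:
  "poly (FE_correction a) y = (q powi (3 - 3 * int a) * y\<^sup>2 - q powi (1 - int a)) / (q\<^sup>2 - 1)"
  by (simp add: FE_correction_def)

text \<open>The coefficient field is infinite, so polynomial identities can be checked at all points, where
the field tools apply.\<close>
lemma poly_eqI_ratfun:
  fixes p r :: "ratfun poly"
  assumes "\<And>y. poly p y = poly r y"
  shows "p = r"
  using assms poly_eq_poly_eq_iff by blast

text \<open>The recursion obtained by moving \<open>F\<close> past one further factor: the new correction comes either from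
the last factor directly or from the old correction, shifted when it passes that factor.\<close>
lemma FE_correction_Suc:
  "smult (qint (int (Suc a))) (FE_correction (Suc a)) =
     smult (inverse (q ^ (2 * a))) (FE_correction 1) + smult (qint (int a)) (q_shift (FE_correction a))"
proof (rule poly_eqI_ratfun)
  fix y
  define A where "A = q ^ a"
  have A: "A \<noteq> 0" by (simp add: A_def q_nonzero)
  have A': "q powi int a = A" "q powi (3 * int a) = A^3" "q ^ (2 * a) = A^2"
    by (simp_all add: A_def power_int_def nat_mult_distrib mult.commute flip: power_mult)
  have e: "q powi (3 - 3 * int a) = q^3 / A^3" "q powi (1 - int a) = q / A"
     "q powi (3 - 3 * int (Suc a)) = 1 / A^3" "q powi (1 - int (Suc a)) = 1 / A"
    "q ^ (2 * a) = A^2" "qint (int (Suc a)) = (q * A - 1 / (q * A)) / (q - inverse q)"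
    "qint (int a) = (A - 1 / A) / (q - inverse q)"
    using q_nonzero A' by (simp_all add: qint_def power_int_diff power_int_add power_int_minus field_simps)
  show "poly (smult (qint (int (Suc a))) (FE_correction (Suc a))) y =
     poly (smult (inverse (q ^ (2 * a))) (FE_correction 1) + smult (qint (int a)) (q_shift (FE_correction a))) y"
    unfolding poly_add poly_smult poly_q_shift poly_FE_correction e q_minus_inverse_eq
    using A q_nonzero q_sq by (simp add: divide_simps) algebra
qed

lemma FF_Echeck_power:
  "FF * Echeck ^ a =
     inverse (q ^ (2 * a)) \<cdot> (Echeck ^ a * FF)
     + qint (int a) \<cdot> (Echeck ^ (a - 1) * at_Kinv (FE_correction a))"
proof (induction a)
  case (Suc a)
  have "FE_correction (Suc 0) = smult (1 / (q\<^sup>2 - 1)) ([:0, 1:] * [:0, 1:] - 1)"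
    by (simp add: FE_correction_def power2_eq_square one_pCons)
  then have 1: "at_Kinv (FE_correction (Suc 0)) = (1 / (q\<^sup>2 - 1)) \<cdot> (Kinv\<^sup>2 - 1)"
    by (simp only: at_Kinv_smult at_Kinv_diff at_Kinv_mult at_Kinv_X at_Kinv_1 power2_eq_square)
  \<comment> \<open>At \<open>a = 0\<close> the truncated exponent is wrong, but then \<open>[a] = 0\<close>.\<close>
  have 2: "qint (int a) \<cdot> (Echeck ^ (a - 1) * Echeck * x) = qint (int a) \<cdot> (Echeck ^ a * x)" for x
    by (cases a) (simp_all add: qint_def flip: power_Suc2)
  have "FF * Echeck ^ Suc a = (FF * Echeck ^ a) * Echeck"
    by (simp add: power_Suc2 mult.assoc del: power_Suc)
  also have "\<dots> = inverse (q ^ (2 * a)) \<cdot> (Echeck ^ a * (FF * Echeck))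
      + qint (int a) \<cdot> (Echeck ^ (a - 1) * Echeck * at_Kinv (q_shift (FE_correction a)))"
    by (simp add: Suc.IH distrib_right smult_uq_mult_left mult.assoc at_Kinv_Echeck)
  also have "\<dots> = inverse (q ^ (2 * Suc a)) \<cdot> (Echeck ^ Suc a * FF) +
    Echeck ^ a * at_Kinv (smult (inverse (q ^ (2 * a))) (FE_correction 1) + smult (qint (int a)) (q_shift (FE_correction a)))"
    unfolding FF_Echeck 2
    by (simp add: 1 at_Kinv_add at_Kinv_smult distrib_left smult_uq_mult_left smult_uq_mult_right uq.scale_right_distrib power_Suc2 mult.assoc power2_eq_square ratfun_mult_ac
     del: power_Suc)
  also have "\<dots> = inverse (q ^ (2 * Suc a)) \<cdot> (Echeck ^ Suc a * FF)
     + qint (int (Suc a)) \<cdot> (Echeck ^ (Suc a - 1) * at_Kinv (FE_correction (Suc a)))"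
    unfolding FE_correction_Suc [symmetric] by (simp add: at_Kinv_smult smult_uq_mult_right)
  finally show ?case .
qed (simp add: qint_def)

lemma qfact_Suc: "qfact (Suc n) = qint (int (Suc n)) * qfact n"
  by (simp add: qfact_def mult.commute)

lemma Echeck_Echeck_dp: "Echeck * Echeck_dp a = qint (int (Suc a)) \<cdot> Echeck_dp (Suc a)"
  using qint_nonzero[of "Suc a"]
  by (simp add: Echeck_dp_def smult_uq_mult_right qfact_Suc del: of_nat_Suc)

lemma FF_FF_dp: "FF * FF_dp a = qint (int (Suc a)) \<cdot> FF_dp (Suc a)"
  using qint_nonzero[of "Suc a"]
  by (simp add: FF_dp_def smult_uq_mult_right qfact_Suc del: of_nat_Suc)

lemma Kinv_Echeck_dp: "Kinv * Echeck_dp a = inverse (q ^ (2 * a)) \<cdot> (Echeck_dp a * Kinv)"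
  by (simp add: Echeck_dp_def smult_uq_mult_right smult_uq_mult_left Kinv_Echeck_power ratfun_mult_ac)

lemma FF_Echeck_dp:
  "FF * Echeck_dp a = inverse (q ^ (2 * a)) \<cdot> (Echeck_dp a * FF)
     + (if a = 0 then 0 else Echeck_dp (a - 1) * at_Kinv (FE_correction a))"
proof (cases a)
  case (Suc b)
  show ?thesis
    using qint_nonzero[of "Suc b"]
    by (simp add: Echeck_dp_def smult_uq_mult_right smult_uq_mult_left FF_Echeck_power Suc
      uq.scale_right_distrib qfact_Suc ratfun_mult_ac del: power_Suc of_nat_Suc)
qed (simp add: Echeck_dp_def qfact_def)

section \<open>Multiplication by t in triangular form\<close>

definition normal_term :: "nat \<Rightarrow> ratfun poly \<Rightarrow> nat \<Rightarrow> uqsl2" where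
  "normal_term a p b = Echeck_dp a * at_Kinv p * FF_dp b"

lemma normal_term_0 [simp]: "normal_term a 0 b = 0" by (simp add: normal_term_def)

lemma normal_term_add: "normal_term a (p + r) b = normal_term a p b + normal_term a r b"
  by (simp add: normal_term_def at_Kinv_add algebra_simps)

lemma normal_term_smult: "normal_term a (smult c p) b = c \<cdot> normal_term a p b"
  by (simp add: normal_term_def at_Kinv_smult smult_uq_mult_left smult_uq_mult_right)

lemma tt_normal_term:
  "tt * normal_term a p b =
     normal_term (Suc a) (smult (qint (int (Suc a))) p) b
     + normal_term a (smult (inverse (q ^ (2 * a)) * qint (int (Suc b))) (q_shift p)) (Suc b)
     + normal_term a (smult (inverse (q ^ (2 * a))) ([:0, 1:] * p)) b
     + (if a = 0 then 0 else normal_term (a - 1) (FE_correction a * p) b)"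
proof -
  have "Echeck * normal_term a p b = normal_term (Suc a) (smult (qint (int (Suc a))) p) b"
    by (simp add: normal_term_smult, simp add: normal_term_def Echeck_Echeck_dp smult_uq_mult_left flip: mult.assoc)
  moreover have "Kinv * normal_term a p b = normal_term a (smult (inverse (q ^ (2 * a))) ([:0, 1:] * p)) b"
    by (simp add: normal_term_smult del: mult_pCons_left,
      simp add: normal_term_def at_Kinv_mult const_0 const_1 Kinv_Echeck_dp smult_uq_mult_left del: mult_pCons_left flip: mult.assoc)
  moreover have "FF * normal_term a p b =
    normal_term a (smult (inverse (q ^ (2 * a)) * qint (int (Suc b))) (q_shift p)) (Suc b)
     + (if a = 0 then 0 else normal_term (a - 1) (FE_correction a * p) b)"
  proof -
    have "FF * normal_term a p b = (FF * Echeck_dp a) * at_Kinv p * FF_dp b"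
      by (simp add: normal_term_def mult.assoc)
    also have "\<dots> = inverse (q ^ (2 * a)) \<cdot> (Echeck_dp a * (FF * at_Kinv p) * FF_dp b)
      + (if a = 0 then 0 else normal_term (a - 1) (FE_correction a * p) b)"
      by (simp add: FF_Echeck_dp normal_term_def at_Kinv_mult distrib_right smult_uq_mult_left mult.assoc)
    also have "Echeck_dp a * (FF * at_Kinv p) * FF_dp b = Echeck_dp a * at_Kinv (q_shift p) * (FF * FF_dp b)"
      by (simp add: FF_at_Kinv mult.assoc)
    finally show ?thesis
      by (simp add: normal_term_smult FF_FF_dp smult_uq_mult_right) (simp add: normal_term_def)
  qed
  ultimately show ?thesis
    by (simp add: tt_def distrib_right)
qed

definition normal_sum :: "nat \<Rightarrow> (nat \<Rightarrow> nat \<Rightarrow> ratfun poly) \<Rightarrow> uqsl2" where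
  "normal_sum n g = (\<Sum>(a, b) \<in> {(a, b). a + b \<le> n}. normal_term a (g a b) b)"

lemma finite_triangle: "finite {(a, b). a + b \<le> (n :: nat)}"
  by (rule finite_subset [of _ "{..n} \<times> {..n}"]) auto

text \<open>The action of \<open>t\<close> on coefficient families. Each summand of \<open>tt_normal_term\<close> is reindexed so that
its target term sits at \<open>(a, b)\<close>. In the first two summands the truncated subtractions \<open>0 - 1\<close> are
harmless because \<open>[0] = 0\<close>; in the last two the guards keep the source pair inside the triangle.\<close>
lemma tt_normal_sum:
  "tt * normal_sum n g = normal_sum (Suc n) (\<lambda>a b.
     smult (qint (int a)) (g (a - 1) b)
     + smult (inverse (q ^ (2 * a)) * qint (int b)) (q_shift (g a (b - 1)))
     + (if a + b \<le> n then smult (inverse (q ^ (2 * a))) ([:0, 1:] * g a b) else 0)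
     + (if a + b < n then FE_correction (Suc a) * g (Suc a) b else 0))"
proof -
  let ?T = "\<lambda>n. {(a, b). a + b \<le> (n :: nat)}"
  have q0: "qint 0 = 0" by (simp add: qint_def)
  have 1: "(\<Sum>(a, b)\<in>?T n. normal_term (Suc a) (smult (qint (int (Suc a))) (g a b)) b)
      = (\<Sum>(a, b)\<in>?T (Suc n). normal_term a (smult (qint (int a)) (g (a - 1) b)) b)"
    by (rule sum.reindex_bij_witness_not_neutral [where S' = "{}" and T' = "{(a, b). a = 0 \<and> b \<le> Suc n}"
        and i = "\<lambda>(a, b). (a - 1, b)" and j = "\<lambda>(a, b). (Suc a, b)"])
      (auto simp: q0 intro: finite_subset [OF _ finite_triangle])
  have 2: "(\<Sum>(a, b)\<in>?T n. normal_term a (smult (inverse (q ^ (2 * a)) * qint (int (Suc b))) (q_shift (g a b))) (Suc b))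
      = (\<Sum>(a, b)\<in>?T (Suc n). normal_term a (smult (inverse (q ^ (2 * a)) * qint (int b)) (q_shift (g a (b - 1)))) b)"
    by (rule sum.reindex_bij_witness_not_neutral [where S' = "{}" and T' = "{(a, b). b = 0 \<and> a \<le> Suc n}"
        and i = "\<lambda>(a, b). (a, b - 1)" and j = "\<lambda>(a, b). (a, Suc b)"])
      (auto simp: q0 intro: finite_subset [OF _ finite_triangle])
  have 3: "(\<Sum>(a, b)\<in>?T n. normal_term a (smult (inverse (q ^ (2 * a))) ([:0, 1:] * g a b)) b)
      = (\<Sum>(a, b)\<in>?T (Suc n). normal_term a (if a + b \<le> n then smult (inverse (q ^ (2 * a))) ([:0, 1:] * g a b) else 0) b)"
    by (rule sum.mono_neutral_cong_left) (auto intro: finite_triangle split: if_splits)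
  \<comment> \<open>Pairs with \<open>a = 0\<close> contribute nothing; they are sent to \<open>(n + 1, 0)\<close>, where the
    guard makes the target summand vanish.\<close>
  have 4: "(\<Sum>(a, b)\<in>?T n. if a = 0 then 0 else normal_term (a - 1) (FE_correction a * g a b) b)
      = (\<Sum>(a, b)\<in>?T (Suc n). normal_term a (if a + b < n then FE_correction (Suc a) * g (Suc a) b else 0) b)"
    by (rule sum.reindex_bij_witness_not_neutral [where T' = "{(a, b). n \<le> a + b \<and> a + b \<le> Suc n}" and S' = "{(a, b). a = 0 \<and> b \<le> n}"
        and j = "\<lambda>(a, b). if a = 0 then (Suc n, 0) else (a - 1, b)" and i = "\<lambda>(a, b). (Suc a, b)"])
      (auto intro: finite_subset [OF _ finite_triangle] split: if_splits)
  show ?thesis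
    unfolding normal_sum_def normal_term_add split_def sum.distrib
    using 1 2 3 4
    by (simp add: sum_distrib_left tt_normal_term split_def sum.distrib del: of_nat_Suc mult_pCons_left)
qed

section \<open>The coefficients and their exponents\<close>

text \<open>The polynomial whose value at \<open>K\<inverse>\<close> is the braces symbol.\<close>
definition brace_poly :: "int \<Rightarrow> nat \<Rightarrow> ratfun poly" where
  "brace_poly a k = (\<Prod>i = 1..k. smult (1 / (q ^ (4 * i) - 1))
     (smult (q powi (4 * a + 4 * int i - 4)) ([:0, 1:]\<^sup>2) - [:q\<^sup>2:]))"

lemma poly_brace: "poly (brace_poly a k) y = (\<Prod>i = 1..k. (q powi (4 * a + 4 * int i - 4) * y\<^sup>2 - q\<^sup>2) / (q ^ (4 * i) - 1))"
  by (simp add: brace_poly_def poly_prod)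

lemma brace_poly_0 [simp]: "brace_poly a 0 = 1" by (simp add: brace_poly_def)

lemma poly_brace_Suc: "poly (brace_poly a (Suc k)) y =
   poly (brace_poly a k) y * ((q powi (4 * a + 4 * int k) * y\<^sup>2 - q\<^sup>2) / (q ^ (4 * k + 4) - 1))"
  by (simp add: poly_brace algebra_simps)

text \<open>Only \<open>K\<^bsup>-2\<^esup>\<close> occurs in the braces symbol and the shift divides it by \<open>q\<^bsup>4\<^esup>\<close>, which is exactly what
lowering \<open>a\<close> by one does to the factors.\<close>
lemma poly_brace_shift: "poly (brace_poly a k) (y / q\<^sup>2) = poly (brace_poly (a - 1) k) y"
  unfolding poly_brace using q_nonzero
  by (intro prod.cong) (simp_all add: power_int_diff power_int_add algebra_simps power_divide flip: power_mult)

lemma prod_shift_first: "prod f {1..Suc k} = f 1 * prod (\<lambda>i. f (Suc i)) {1..k}" for f :: "nat \<Rightarrow> 'a::comm_monoid_mult"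
  by (simp add: prod.atLeast_Suc_atMost prod.atLeast_Suc_atMost_Suc_shift del: prod.cl_ivl_Suc)

text \<open>Lowering \<open>a\<close> moves the window of factors by one place, so \<open>{h; a-1; k+1}\<close> extends
\<open>{h; a; k}\<close> at the front where \<open>{h; a; k+1}\<close> extends it at the back. Hence all braces symbols in
the recurrence are multiples of \<open>{h; a; k}\<close>.\<close>
lemma poly_brace_pred_Suc: "poly (brace_poly (a - 1) (Suc k)) y = poly (brace_poly a k) y * ((q powi (4 * a - 4) * y\<^sup>2 - q\<^sup>2) / (q ^ (4 * k + 4) - 1))"
proof -
  have "poly (brace_poly (a - 1) (Suc k)) y = (\<Prod>i = 1..Suc k. q powi (4 * (a - 1) + 4 * int i - 4) * y\<^sup>2 - q\<^sup>2) / (\<Prod>i = 1..Suc k. q ^ (4 * i) - 1)"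
    by (simp only: poly_brace prod_dividef)
  also have "(\<Prod>i = 1..Suc k. q powi (4 * (a - 1) + 4 * int i - 4) * y\<^sup>2 - q\<^sup>2) =
     (q powi (4 * a - 4) * y\<^sup>2 - q\<^sup>2) * (\<Prod>i = 1..k. q powi (4 * a + 4 * int i - 4) * y\<^sup>2 - q\<^sup>2)"
    unfolding prod_shift_first by (simp add: algebra_simps)
  finally show ?thesis
    by (simp add: poly_brace prod_dividef algebra_simps)
qed

lemma choose2_even: "choose2 (2 * k) = 2 * k * k - k"
proof -
  have "2 * k * (2 * k - 1) = 2 * (2 * k * k - k)" by (simp add: algebra_simps)
  then show ?thesis unfolding choose2_def by simp
qed

lemma choose2_odd: "choose2 (2 * k + 1) = 2 * k * k + k"
proof -
  have "(2 * k + 1) * (2 * k + 1 - 1) = 2 * (2 * k * k + k)" by (simp add: algebra_simps)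
  then show ?thesis unfolding choose2_def by simp
qed

lemma choose2_pred: "choose2 (2 * k - 1) = 2 * k * k - 3 * k + 1"
  using choose2_odd[of "k - 1"] by (simp add: algebra_simps)

text \<open>The polynomials \<open>P(n,d)\<close> attached to the degree \<open>n\<close> and the deficit \<open>d = n - a - b\<close>. The
factor \<open>q\<^bsup>-ab\<^esup>\<close> of the coefficients is left out here, since what remains depends on \<open>a\<close> and \<open>b\<close> through
\<open>d\<close> only.\<close>
definition t_coeff :: "nat \<Rightarrow> nat \<Rightarrow> ratfun poly" where
  "t_coeff n d =
    (let m = int (n div 2); c = d div 2 in
     if even n then
       if even d then smult (q powi (choose2 (2 * int c - 1) - 1)) (brace_poly (2 - m) c)
       else smult (q powi (choose2 (2 * int c) + 1 - 2 * m)) (brace_poly (2 - m) c * [:0, 1:])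
     else
       if even d then smult (q powi (choose2 (2 * int c))) (brace_poly (1 - m) c)
       else smult (q powi (choose2 (2 * int c + 1) - 2 * m)) (brace_poly (1 - m) c * [:0, 1:]))"

lemma t_coeff_even_even: "t_coeff (2 * m) (2 * c) = smult (q powi (choose2 (2 * int c - 1) - 1)) (brace_poly (2 - int m) c)"
  by (simp add: t_coeff_def Let_def)

lemma t_coeff_even_odd: "t_coeff (2 * m) (2 * c + 1) = smult (q powi (choose2 (2 * int c) + 1 - 2 * int m)) (brace_poly (2 - int m) c * [:0, 1:])"
  by (simp add: t_coeff_def Let_def)

lemma t_coeff_odd_even: "t_coeff (2 * m + 1) (2 * c) = smult (q powi (choose2 (2 * int c))) (brace_poly (1 - int m) c)"
  by (simp add: t_coeff_def Let_def)

lemma t_coeff_odd_odd: "t_coeff (2 * m + 1) (2 * c + 1) = smult (q powi (choose2 (2 * int c + 1) - 2 * int m)) (brace_poly (1 - int m) c * [:0, 1:])"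
  by (simp add: t_coeff_def Let_def)

text \<open>The degree \<open>n - 1\<close> for \<open>n = 2m\<close> in terms of \<open>m\<close>: it uses the same offset \<open>2 - m\<close> as degree
\<open>2m\<close>, so the two share their braces symbols.\<close>
lemma t_coeff_pred_even:
  assumes "m > 0"
  shows "t_coeff (2 * m - 1) (2 * c) = smult (q powi (choose2 (2 * int c))) (brace_poly (2 - int m) c)"
proof -
  from assms obtain r where "m = Suc r" by (cases m) auto
  then show ?thesis using t_coeff_odd_even[of r c] by simp
qed

lemma t_coeff_pred_odd:
  assumes "m > 0"
  shows "t_coeff (2 * m - 1) (2 * c + 1) =
    smult (q powi (choose2 (2 * int c + 1) + 2 - 2 * int m)) (brace_poly (2 - int m) c * [:0, 1:])"
proof -
  from assms obtain r where "m = Suc r" by (cases m) auto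
  then show ?thesis using t_coeff_odd_odd[of r c] by (simp add: algebra_simps)
qed

lemma q_power_powi: "(q ^ n) powi i = q powi (i * int n)"
  using power_int_mult[of q "int n" i] by (simp add: mult.commute)

text \<open>With \<open>d = 2k + 2\<close> or \<open>2k + 3\<close>, every exponent of \<open>q\<close> in the recurrence has this form. The
quadratic part \<open>2k\<^sup>2\<close> is common to all terms and cancels; the rest is a monomial in
\<open>q\<^bsup>k\<^esup>\<close>, \<open>q\<^bsup>2m\<^esup>\<close> and \<open>q\<close>.\<close>
lemma q_powi_split:
  assumes "e = 2 * int k * int k + i * int k + l * (2 * int m) + j"
  shows "q powi e = q powi (2 * int k * int k) * (q ^ k) powi i * (q ^ (2 * m)) powi l * q powi j"
  using q_nonzero unfolding assms q_power_powi of_nat_mult of_nat_numeral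
  by (simp only: power_int_add simp_thms)

lemma brace_factor_nonzero: "(q ^ k) ^ 4 * q ^ 4 - 1 \<noteq> 0"
proof -
  have "q ^ (k * 4 + 4) \<noteq> 1"
    unfolding q_power_eq_1_iff by simp
  then show ?thesis
    unfolding power_add power_mult by simp
qed

lemma qint_eq: "qint (int n) = q * (q ^ n - inverse (q ^ n)) / (q\<^sup>2 - 1)"
  by (simp add: qint_def q_minus_inverse_eq power_int_minus)

section \<open>The four Laurent polynomial identities\<close>

text \<open>Rules that cancel a variable against its inverse inside a sorted product. Inverses are separate
variables below, so that expansion into a sum of sorted monomials followed by these rules is a
normalization of Laurent polynomials and no denominators have to be cleared.\<close>
lemma laurent_normal:
  fixes A1 A2 :: "'a :: comm_ring_1"
  assumes "A1 * A2 = 1"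
  shows "A1 * A2 = 1" "A1 * (A2 * z) = z"
  using assms by (simp_all flip: mult.assoc)

lemmas expand_powers = power2_eq_square power3_eq_cube power4_eq_xxxx
text \<open>Here \<open>A1 = q\<^bsup>a\<^esup>\<close>, \<open>B1 = q\<^bsup>b\<^esup>\<close>, \<open>C1 = q\<^bsup>k\<^esup>\<close>, \<open>v1 = q\<close> and \<open>W1 = q\<^bsup>2m\<^esup>\<close>, the index \<open>2\<close> marks
inverses, and \<open>z\<close> is the square of the polynomial variable. \<open>Z1 / w\<close> and \<open>Z2 / w\<close> are the last and
the first factor by which the braces symbols exceed their common part, and \<open>u\<close> comes from the
denominator of the quantum integers. The equations for \<open>W1\<close> express \<open>a + b + d = n + 1\<close>. The first
word in each name is the parity of \<open>n\<close>, the second that of \<open>d\<close>.\<close>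
context
  fixes A1 A2 B1 B2 C1 C2 v1 v2 z :: "'a :: comm_ring_1"
  assumes inv: "A1 * A2 = 1" "B1 * B2 = 1" "C1 * C2 = 1" "v1 * v2 = 1"
begin

lemma laurent_identity_odd_even:
  assumes "W1 = A1 * B1 * C1^2" "W2 = A2 * B2 * C2^2"
    and "u = v1^2 - 1" "w = C1^4 * v1^4 - 1"
    and "Z1 = v1^4 * C1^4 * W2^2 * z - v1^2" "Z2 = W2^2 * z - v1^2"
  shows "v1 * (A1 - A2) * B1 * (C1^3 * v1 * Z1) + A2 * (v1 * (B1 - B2)) * (C1^3 * v1 * Z2)
     + w * B2 * (A2^3 * z - A2) * C2 + u * w * A2^2 * C1 * W2 * z
   = v1 * (v1^2 * W1 - v2^2 * W2) * (C1 * v2 * Z1)"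
  unfolding assms by (simp add: expand_powers algebra_simps inv inv [THEN laurent_normal(2)])

lemma laurent_identity_odd_odd:
  assumes "W1 = A1 * B1 * C1^2 * v1" "W2 = A2 * B2 * C2^2 * v2"
    and "u = v1^2 - 1" "w = C1^4 * v1^4 - 1"
    and "Z1 = v1^4 * C1^4 * W2^2 * z - v1^2" "Z2 = W2^2 * z - v1^2"
  shows "v1 * (A1 - A2) * B1 * (C1^3 * C1^2 * v1^3 * W2 * Z1) + A2 * (v1 * (B1 - B2)) * (C1^3 * C1^2 * v1 * W2 * Z2)
     + w * B2 * (A2^3 * z - A2) * C1 * W2 + u * A2^2 * C1^3 * v1 * Z1
   = v1 * (v1^2 * W1 - v2^2 * W2) * (C1^3 * W2 * Z1)"
  unfolding assms by (simp add: expand_powers algebra_simps inv inv [THEN laurent_normal(2)])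

lemma laurent_identity_even_even:
  assumes "W1 = A1 * B1 * C1^2 * v1" "W2 = A2 * B2 * C2^2 * v2"
    and "u = v1^2 - 1" "w = C1^4 * v1^4 - 1"
    and "Z1 = v1^4 * v1^4 * C1^4 * W2^2 * z - v1^2" "Z2 = v1^4 * W2^2 * z - v1^2"
  shows "v1 * (A1 - A2) * B1 * (C1 * v2 * Z1) + A2 * (v1 * (B1 - B2)) * (C1 * v2 * Z2)
     + w * B2 * (A2^3 * z - A2) * C2^3 + u * w * A2^2 * v1 * C2 * W2 * z
   = v1 * (v1 * W1 - v2 * W2) * (C1^3 * v1 * Z2) + w * v1 * (W1 - W2) * C2"
  unfolding assms by (simp add: expand_powers algebra_simps inv inv [THEN laurent_normal(2)])

lemma laurent_identity_even_odd:
  assumes "W1 = A1 * B1 * C1^2 * v1^2" "W2 = A2 * B2 * C2^2 * v2^2"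
    and "u = v1^2 - 1" "w = C1^4 * v1^4 - 1"
    and "Z1 = v1^4 * v1^4 * C1^4 * W2^2 * z - v1^2" "Z2 = v1^4 * W2^2 * z - v1^2"
  shows "v1 * (A1 - A2) * B1 * (C1^3 * v1^2 * W2 * Z1) + A2 * (v1 * (B1 - B2)) * (C1^3 * W2 * Z2)
     + w * B2 * (A2^3 * z - A2) * v1 * C2 * W2 + u * A2^2 * C1 * v2 * Z1
   = v1 * (v1 * W1 - v2 * W2) * (C1^3 * C1^2 * v1^3 * W2 * Z2) + w * v1 * (W1 - W2) * C1 * v1^2 * W2"
  unfolding assms by (simp add: expand_powers algebra_simps inv inv [THEN laurent_normal(2)])
end
section \<open>The recurrence for the coefficients\<close>

text \<open>Abbreviations for one instance of the recurrence with deficit \<open>2k + 2\<close> or \<open>2k + 3\<close>. The degree is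
\<open>n = 2m + 1\<close> if \<open>r = 0\<close> and \<open>n = 2m\<close> if \<open>r = 1\<close>; in both cases the common braces symbol is
\<open>{h; 1 + r - m; k}\<close>, with value \<open>H\<close> at the point \<open>y\<close>, and \<open>G\<close> is the common power of \<open>q\<close>.\<close>
locale coeff_step =
  fixes a b k m r :: nat and y :: ratfun
  fixes G A B C W H u w Z1 Z2 :: ratfun
  defines "G \<equiv> q powi (2 * int k * int k)"
    and "A \<equiv> q ^ a" and "B \<equiv> q ^ b" and "C \<equiv> q ^ k" and "W \<equiv> q ^ (2 * m)"
    and "H \<equiv> poly (brace_poly (1 + int r - int m) k) y"
    and "u \<equiv> q\<^sup>2 - 1" and "w \<equiv> C ^ 4 * q ^ 4 - 1"
    and "Z1 \<equiv> q ^ 4 * (q ^ 4) ^ r * C ^ 4 * (inverse W)\<^sup>2 * y\<^sup>2 - q\<^sup>2"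
    and "Z2 \<equiv> (q ^ 4) ^ r * (inverse W)\<^sup>2 * y\<^sup>2 - q\<^sup>2"
begin

lemma nonzero: "q \<noteq> 0" "A \<noteq> 0" "B \<noteq> 0" "C \<noteq> 0" "W \<noteq> 0" "u \<noteq> 0" "w \<noteq> 0"
  using q_nonzero q_sq brace_factor_nonzero[of k]
  by (simp_all add: A_def B_def C_def W_def u_def w_def)

lemma brace_values:
  "poly (brace_poly (1 + int r - int m) (k + 1)) y = H * Z1 / w"
  "poly (brace_poly (1 + int r - int m) (k + 1)) (y / q\<^sup>2) = H * Z2 / w"
  "poly (brace_poly (int r - int m) (k + 1)) y = H * Z2 / w"
proof -
  let ?s = "1 + int r - int m"
  have w: "q ^ (4 * k + 4) - 1 = w"
    by (simp add: w_def C_def power_add mult.commute flip: power_mult)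
  have Z1: "q powi (4 * ?s + 4 * int k) * y\<^sup>2 - q\<^sup>2 = Z1"
  proof -
    have "4 * ?s + 4 * int k = int (4 + 4 * r + k * 4) - int ((2 * m) * 2)"
      by simp
    then have "q powi (4 * ?s + 4 * int k) = q ^ (4 + 4 * r + k * 4) / q ^ ((2 * m) * 2)"
      using q_nonzero by (simp only: power_int_diff power_int_of_nat simp_thms)
    then show ?thesis
      unfolding power_add power_mult
      by (simp add: Z1_def C_def W_def divide_inverse power_inverse power_mult)
  qed
  have Z2: "q powi (4 * ?s - 4) * y\<^sup>2 - q\<^sup>2 = Z2"
  proof -
    have "4 * ?s - 4 = int (4 * r) - int ((2 * m) * 2)"
      by simp
    then have "q powi (4 * ?s - 4) = q ^ (4 * r) / q ^ ((2 * m) * 2)"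
      using q_nonzero by (simp only: power_int_diff power_int_of_nat simp_thms)
    then show ?thesis
      unfolding power_add power_mult
      by (simp add: Z2_def W_def divide_inverse power_inverse power_mult)
  qed
  have pred: "poly (brace_poly (?s - 1) (k + 1)) y = H * Z2 / w"
    using poly_brace_pred_Suc[of ?s k y] by (simp only: Z2 w H_def Suc_eq_plus1 times_divide_eq_right)
  show "poly (brace_poly ?s (k + 1)) y = H * Z1 / w"
    using poly_brace_Suc[of ?s k y] by (simp only: Z1 w H_def Suc_eq_plus1 times_divide_eq_right)
  show "poly (brace_poly ?s (k + 1)) (y / q\<^sup>2) = H * Z2 / w"
    using pred by (simp only: poly_brace_shift)
  show "poly (brace_poly (int r - int m) (k + 1)) y = H * Z2 / w"
    using pred by simp
qed

lemmas q_powi_monomial = q_powi_split[where k = k and m = m, folded G_def C_def W_def]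

text \<open>In this and the next three lemmas both sides of the recurrence are \<open>G H / (u w)\<close> times the
corresponding Laurent polynomial identity, for odd deficit with a further factor \<open>y\<close>.\<close>
lemma odd_even:
  assumes "r = 0" "a + b + 2 * (k + 1) = 2 * m + 2"
  shows "qint (int a) * B * poly (t_coeff (2 * m + 1) (2 * (k + 1))) y
     + inverse A * qint (int b) * poly (t_coeff (2 * m + 1) (2 * (k + 1))) (y / q\<^sup>2)
     + inverse B * ((inverse A ^ 3 * y\<^sup>2 - inverse A) / u) * poly (t_coeff (2 * m + 1) (2 * k)) y
     + inverse A ^ 2 * y * poly (t_coeff (2 * m + 1) (2 * k + 1)) y
     = qint (int (2 * m + 2)) * poly (t_coeff (2 * (m + 1)) (2 * (k + 1))) y"
proof -
  have "2 * m = a + b + k * 2"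
    using assms(2) by simp
  then have W: "W = A * B * C\<^sup>2"
    by (simp add: W_def A_def B_def C_def power_add power_mult)
  have e1: "q powi choose2 (2 * int (k + 1)) = G * C ^ 3 * q"
    by (subst q_powi_monomial[of _ 3 0 1], use choose2_even[of "int (k + 1)"] in \<open>simp_all add: algebra_simps\<close>)
  have e2: "q powi choose2 (2 * int k) = G * inverse C"
    by (subst q_powi_monomial[of _ "-1" 0 0]) (use choose2_even[of "int k"] in \<open>simp_all add: algebra_simps power_int_minus\<close>)
  have e3: "q powi (choose2 (2 * int k + 1) - 2 * int m) = G * C * inverse W"
    by (subst q_powi_monomial[of _ 1 "-1" 0]) (use choose2_odd[of "int k"] in \<open>simp_all add: algebra_simps power_int_minus\<close>)
  have e4: "q powi (choose2 (2 * int (k + 1) - 1) - 1) = G * C * inverse q"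
    by (subst q_powi_monomial[of _ 1 0 "-1"]) (use choose2_pred[of "int (k + 1)"] in \<open>simp_all add: algebra_simps power_int_minus\<close>)
  have n: "q ^ (2 * m + 2) = q\<^sup>2 * W"
    by (simp add: W_def power_add power2_eq_square)
  have L: "q * (A - inverse A) * B * (C^3 * q * Z1) + inverse A * (q * (B - inverse B)) * (C^3 * q * Z2)
       + w * inverse B * (inverse A^3 * y\<^sup>2 - inverse A) * inverse C + u * w * inverse A^2 * C * inverse W * y\<^sup>2
     = q * (q^2 * W - inverse q^2 * inverse W) * (C * inverse q * Z1)"
    by (rule laurent_identity_odd_even[where z = "y\<^sup>2"])
      (use nonzero in \<open>simp_all add: Z1_def Z2_def u_def w_def W assms(1) power_inverse\<close>)
  have H: "poly (brace_poly (1 - int m) k) y = H"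
    by (simp add: H_def assms(1))
  from arg_cong[OF L, of "\<lambda>x. G * H * x / (u * w)"] nonzero brace_values show ?thesis
    unfolding t_coeff_odd_even t_coeff_odd_odd t_coeff_even_even poly_smult poly_mult e1 e2 e3 e4
      qint_eq n A_def [symmetric] B_def [symmetric] u_def [symmetric]
    by (simp add: assms(1) add_divide_distrib distrib_left power2_eq_square H mult_ac)
qed

lemma odd_odd:
  assumes "r = 0" "a + b + (2 * (k + 1) + 1) = 2 * m + 2"
  shows "qint (int a) * B * poly (t_coeff (2 * m + 1) (2 * (k + 1) + 1)) y
     + inverse A * qint (int b) * poly (t_coeff (2 * m + 1) (2 * (k + 1) + 1)) (y / q\<^sup>2)
     + inverse B * ((inverse A ^ 3 * y\<^sup>2 - inverse A) / u) * poly (t_coeff (2 * m + 1) (2 * k + 1)) y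
     + inverse A ^ 2 * y * poly (t_coeff (2 * m + 1) (2 * (k + 1))) y
     = qint (int (2 * m + 2)) * poly (t_coeff (2 * (m + 1)) (2 * (k + 1) + 1)) y"
proof -
  have "2 * m = a + b + k * 2 + 1"
    using assms(2) by simp
  then have W: "W = A * B * C\<^sup>2 * q"
    unfolding W_def A_def B_def C_def by (simp only: power_add power_mult power_one_right)
  have e1: "q powi (choose2 (2 * int (k + 1) + 1) - 2 * int m) = G * (C ^ 3 * C\<^sup>2) * q ^ 3 * inverse W"
    by (subst q_powi_monomial[of _ 5 "-1" 3], use choose2_odd[of "int (k + 1)"] in
      \<open>simp_all add: algebra_simps power_int_minus flip: power_add\<close>)
  have e2: "q powi (choose2 (2 * int k + 1) - 2 * int m) = G * C * inverse W"
    by (subst q_powi_monomial[of _ 1 "-1" 0]) (use choose2_odd[of "int k"] in \<open>simp_all add: algebra_simps power_int_minus\<close>)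
  have e3: "q powi choose2 (2 * int (k + 1)) = G * C ^ 3 * q"
    by (subst q_powi_monomial[of _ 3 0 1], use choose2_even[of "int (k + 1)"] in \<open>simp_all add: algebra_simps\<close>)
  have e4: "q powi (choose2 (2 * int (k + 1)) + 1 - 2 * int (m + 1)) = G * C ^ 3 * inverse W"
    by (subst q_powi_monomial[of _ 3 "-1" 0], use choose2_even[of "int (k + 1)"] in
      \<open>simp_all add: algebra_simps power_int_minus\<close>)
  have n: "q ^ (2 * m + 2) = q\<^sup>2 * W"
    by (simp add: W_def power_add power2_eq_square)
  have L: "q * (A - inverse A) * B * (C^3 * C^2 * q^3 * inverse W * Z1)
       + inverse A * (q * (B - inverse B)) * (C^3 * C^2 * q * inverse W * Z2)
       + w * inverse B * (inverse A^3 * y\<^sup>2 - inverse A) * C * inverse W + u * inverse A^2 * C^3 * q * Z1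
     = q * (q^2 * W - inverse q^2 * inverse W) * (C^3 * inverse W * Z1)"
    by (rule laurent_identity_odd_odd[where z = "y\<^sup>2" and ?C2.0 = "inverse C"])
      (use nonzero in \<open>simp_all add: Z1_def Z2_def u_def w_def W assms(1) power_inverse\<close>)
  have H: "poly (brace_poly (1 - int m) k) y = H"
    by (simp add: H_def assms(1))
  from arg_cong[OF L, of "\<lambda>x. G * H * y * x / (u * w)"] nonzero brace_values show ?thesis
    unfolding t_coeff_odd_even t_coeff_odd_odd t_coeff_even_odd poly_smult poly_mult e1 e2 e3 e4
      qint_eq n A_def [symmetric] B_def [symmetric] u_def [symmetric]
    by (simp add: assms(1) add_divide_distrib distrib_left power2_eq_square power3_eq_cube H mult_ac)
qed

lemma even_even:
  assumes "r = 1" "a + b + 2 * (k + 1) = 2 * m + 1"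
  shows "qint (int a) * B * poly (t_coeff (2 * m) (2 * (k + 1))) y
     + inverse A * qint (int b) * poly (t_coeff (2 * m) (2 * (k + 1))) (y / q\<^sup>2)
     + inverse B * ((inverse A ^ 3 * y\<^sup>2 - inverse A) / u) * poly (t_coeff (2 * m) (2 * k)) y
     + inverse A ^ 2 * y * poly (t_coeff (2 * m) (2 * k + 1)) y
     = qint (int (2 * m + 1)) * poly (t_coeff (2 * m + 1) (2 * (k + 1))) y
       + qint (int (2 * m)) * poly (t_coeff (2 * m - 1) (2 * k)) y"
proof -
  have "2 * m = a + b + k * 2 + 1" and m: "m > 0"
    using assms(2) by simp_all
  then have W: "W = A * B * C\<^sup>2 * q"
    unfolding W_def A_def B_def C_def by (simp only: power_add power_mult power_one_right)
  have e1: "q powi (choose2 (2 * int (k + 1) - 1) - 1) = G * C * inverse q"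
    by (subst q_powi_monomial[of _ 1 0 "-1"]) (use choose2_pred[of "int (k + 1)"] in \<open>simp_all add: algebra_simps power_int_minus\<close>)
  have e2: "q powi (choose2 (2 * int k - 1) - 1) = G * inverse C ^ 3"
    by (subst q_powi_monomial[of _ "-3" 0 0]) (use choose2_pred[of "int k"] in \<open>simp_all add: algebra_simps power_int_minus power_inverse\<close>)
  have e3: "q powi (choose2 (2 * int k) + 1 - 2 * int m) = G * q * inverse C * inverse W"
    by (subst q_powi_monomial[of _ "-1" "-1" 1]) (use choose2_even[of "int k"] in \<open>simp_all add: algebra_simps power_int_minus\<close>)
  have e4: "q powi choose2 (2 * int (k + 1)) = G * C ^ 3 * q"
    by (subst q_powi_monomial[of _ 3 0 1], use choose2_even[of "int (k + 1)"] in \<open>simp_all add: algebra_simps\<close>)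
  have e5: "q powi choose2 (2 * int k) = G * inverse C"
    by (subst q_powi_monomial[of _ "-1" 0 0]) (use choose2_even[of "int k"] in \<open>simp_all add: algebra_simps power_int_minus\<close>)
  have n: "q ^ (2 * m + 1) = q * W" "q ^ (2 * m) = W"
    by (simp_all add: W_def)
  have L: "q * (A - inverse A) * B * (C * inverse q * Z1) + inverse A * (q * (B - inverse B)) * (C * inverse q * Z2)
       + w * inverse B * (inverse A^3 * y\<^sup>2 - inverse A) * inverse C^3 + u * w * inverse A^2 * q * inverse C * inverse W * y\<^sup>2
     = q * (q * W - inverse q * inverse W) * (C^3 * q * Z2) + w * q * (W - inverse W) * inverse C"
    by (rule laurent_identity_even_even[where z = "y\<^sup>2"])
      (use nonzero in \<open>simp_all add: Z1_def Z2_def u_def w_def W assms(1) power_inverse\<close>)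
  have H: "poly (brace_poly (2 - int m) k) y = H"
    by (simp add: H_def assms(1))
  from arg_cong[OF L, of "\<lambda>x. G * H * x / (u * w)"] nonzero brace_values show ?thesis
    unfolding t_coeff_odd_even t_coeff_even_odd t_coeff_even_even t_coeff_pred_even[OF m]
      poly_smult poly_mult e1 e2 e3 e4 e5
      qint_eq n A_def [symmetric] B_def [symmetric] u_def [symmetric]
    by (simp add: assms(1) add_divide_distrib distrib_left power2_eq_square H mult_ac)
qed

lemma even_odd:
  assumes "r = 1" "a + b + (2 * (k + 1) + 1) = 2 * m + 1"
  shows "qint (int a) * B * poly (t_coeff (2 * m) (2 * (k + 1) + 1)) y
     + inverse A * qint (int b) * poly (t_coeff (2 * m) (2 * (k + 1) + 1)) (y / q\<^sup>2)
     + inverse B * ((inverse A ^ 3 * y\<^sup>2 - inverse A) / u) * poly (t_coeff (2 * m) (2 * k + 1)) y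
     + inverse A ^ 2 * y * poly (t_coeff (2 * m) (2 * (k + 1))) y
     = qint (int (2 * m + 1)) * poly (t_coeff (2 * m + 1) (2 * (k + 1) + 1)) y
       + qint (int (2 * m)) * poly (t_coeff (2 * m - 1) (2 * k + 1)) y"
proof -
  have "2 * m = a + b + k * 2 + 2" and m: "m > 0"
    using assms(2) by simp_all
  then have W: "W = A * B * C\<^sup>2 * q\<^sup>2"
    unfolding W_def A_def B_def C_def by (simp only: power_add power_mult)
  have e1: "q powi (choose2 (2 * int (k + 1)) + 1 - 2 * int m) = G * C ^ 3 * q\<^sup>2 * inverse W"
    by (subst q_powi_monomial[of _ 3 "-1" 2], use choose2_even[of "int (k + 1)"] in
      \<open>simp_all add: algebra_simps power_int_minus\<close>)
  have e2: "q powi (choose2 (2 * int k) + 1 - 2 * int m) = G * q * inverse C * inverse W"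
    by (subst q_powi_monomial[of _ "-1" "-1" 1]) (use choose2_even[of "int k"] in \<open>simp_all add: algebra_simps power_int_minus\<close>)
  have e3: "q powi (choose2 (2 * int (k + 1) - 1) - 1) = G * C * inverse q"
    by (subst q_powi_monomial[of _ 1 0 "-1"]) (use choose2_pred[of "int (k + 1)"] in \<open>simp_all add: algebra_simps power_int_minus\<close>)
  have e4: "q powi (choose2 (2 * int (k + 1) + 1) - 2 * int m) = G * (C ^ 3 * C\<^sup>2) * q ^ 3 * inverse W"
    by (subst q_powi_monomial[of _ 5 "-1" 3], use choose2_odd[of "int (k + 1)"] in
      \<open>simp_all add: algebra_simps power_int_minus flip: power_add\<close>)
  have e5: "q powi (choose2 (2 * int k + 1) + 2 - 2 * int m) = G * C * q\<^sup>2 * inverse W"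
    by (subst q_powi_monomial[of _ 1 "-1" 2]) (use choose2_odd[of "int k"] in \<open>simp_all add: algebra_simps power_int_minus\<close>)
  have n: "q ^ (2 * m + 1) = q * W" "q ^ (2 * m) = W"
    by (simp_all add: W_def)
  have L: "q * (A - inverse A) * B * (C^3 * q^2 * inverse W * Z1)
       + inverse A * (q * (B - inverse B)) * (C^3 * inverse W * Z2)
       + w * inverse B * (inverse A^3 * y\<^sup>2 - inverse A) * q * inverse C * inverse W + u * inverse A^2 * C * inverse q * Z1
     = q * (q * W - inverse q * inverse W) * (C^3 * C^2 * q^3 * inverse W * Z2)
       + w * q * (W - inverse W) * C * q^2 * inverse W"
    by (rule laurent_identity_even_odd[where z = "y\<^sup>2"])
      (use nonzero in \<open>simp_all add: Z1_def Z2_def u_def w_def W assms(1) power_inverse\<close>)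
  have H: "poly (brace_poly (2 - int m) k) y = H"
    by (simp add: H_def assms(1))
  from arg_cong[OF L, of "\<lambda>x. G * H * y * x / (u * w)"] nonzero brace_values show ?thesis
    unfolding t_coeff_even_even t_coeff_odd_odd t_coeff_even_odd t_coeff_pred_odd[OF m]
      poly_smult poly_mult e1 e2 e3 e4 e5
      qint_eq n A_def [symmetric] B_def [symmetric] u_def [symmetric]
    by (simp add: assms(1) add_divide_distrib distrib_left power2_eq_square power3_eq_cube H mult_ac)
qed

end

lemma t_coeff_0: "t_coeff n 0 = 1"
  by (simp add: t_coeff_def choose2_def Let_def)

text \<open>Deficits \<open>0\<close> and \<open>1\<close> lie outside the pattern \<open>2k + 2\<close>, \<open>2k + 3\<close>. There all braces symbols are \<open>1\<close> and
the coefficients no longer depend on the parity of the degree.\<close>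
lemma t_coeff_1: "t_coeff n 1 = smult (q powi (1 - int n)) [:0, 1:]"
proof (cases "even n")
  case True
  then obtain m where "n = 2 * m" by blast
  then show ?thesis
    using t_coeff_even_odd[of m 0] by (simp add: choose2_def)
next
  case False
  then obtain m where "n = 2 * m + 1" using oddE by blast
  then show ?thesis
    using t_coeff_odd_odd[of m 0] by (simp add: choose2_def)
qed

text \<open>This is the comparison of coefficients at \<open>(a, b)\<close> in \<open>t \<cdot> t_odd n\<close>, divided by \<open>q\<^bsup>-ab\<^esup>\<close>. For
\<open>d = 0\<close> it is the addition formula \<open>[a] q\<^bsup>b\<^esup> + [b] q\<^bsup>-a\<^esup> = [a + b]\<close>, and for \<open>d \<ge> 2\<close> it is one of the
four cases above.\<close>
lemma t_coeff_recurrence: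
  assumes "a + b + d = n + 1"
  shows "smult (qint (int a) * q ^ b) (t_coeff n d)
     + smult (inverse (q ^ a) * qint (int b)) (q_shift (t_coeff n d))
     + (if d \<ge> 2 then smult (inverse (q ^ b)) (FE_correction (Suc a) * t_coeff n (d - 2)) else 0)
     + (if d \<ge> 1 then smult (inverse (q ^ (2 * a))) ([:0, 1:] * t_coeff n (d - 1)) else 0)
     = smult (qint (int (n + 1))) (t_coeff (n + 1) d)
     + (if even n \<and> d \<ge> 2 then smult (qint (int n)) (t_coeff (n - 1) (d - 2)) else 0)"
proof (rule poly_eqI_ratfun)
  fix y
  have FE: "poly (FE_correction (Suc a)) y = (inverse (q ^ a) ^ 3 * y\<^sup>2 - inverse (q ^ a)) / (q\<^sup>2 - 1)"
  proof -
    have "q powi (3 - 3 * int (Suc a)) = inverse (q powi (int a * 3))"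
      "q powi (1 - int (Suc a)) = inverse (q powi (int a))"
      using q_nonzero by (simp_all add: mult.commute power_int_minus)
    then show ?thesis
      by (simp only: poly_FE_correction power_int_mult power_int_of_nat power_int_numeral power_inverse)
  qed
  have A2: "inverse (q ^ (2 * a)) = inverse (q ^ a) ^ 2"
    by (simp add: power_inverse mult.commute flip: power_mult)
  let ?lhs = "qint (int a) * q ^ b * poly (t_coeff n d) y
     + inverse (q ^ a) * qint (int b) * poly (t_coeff n d) (y / q\<^sup>2)
     + (if d \<ge> 2 then inverse (q ^ b) * ((inverse (q ^ a) ^ 3 * y\<^sup>2 - inverse (q ^ a)) / (q\<^sup>2 - 1)) * poly (t_coeff n (d - 2)) y else 0)
     + (if d \<ge> 1 then inverse (q ^ a) ^ 2 * y * poly (t_coeff n (d - 1)) y else 0)"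
  let ?rhs = "qint (int (n + 1)) * poly (t_coeff (n + 1) d) y
     + (if even n \<and> d \<ge> 2 then qint (int n) * poly (t_coeff (n - 1) (d - 2)) y else 0)"
  consider (0) "d = 0" | (1) "d = 1" | (even) k where "d = 2 * (k + 1)" | (odd) k where "d = 2 * (k + 1) + 1"
  proof (cases "even d")
    case True
    then obtain c where "d = 2 * c" by blast
    then show ?thesis using 0 even by (cases c) auto
  next
    case False
    then obtain c where "d = 2 * c + 1" using oddE by blast
    then show ?thesis using 1 odd by (cases c) auto
  qed
  then have "?lhs = ?rhs"
  proof cases
    case 0
    then have "n + 1 = a + b" using assms by simp
    then show ?thesis
      unfolding 0 qint_eq using q_nonzero q_sq
      by (simp add: t_coeff_0 power_add divide_simps) (simp add: algebra_simps)
  next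
    case 1
    then have n: "n = a + b" using assms by simp
    have e: "q powi (1 - int n) = q / (q ^ a * q ^ b)" "q powi (1 - int (n + 1)) = 1 / (q ^ a * q ^ b)"
      using q_nonzero by (simp_all add: n power_int_diff power_int_add power_int_minus divide_inverse)
    have "n + 1 = a + b + 1" using n by simp
    then show ?thesis
      unfolding 1 t_coeff_1 e qint_eq using q_nonzero q_sq
      by (simp add: t_coeff_0 power_add divide_simps) (simp add: algebra_simps power2_eq_square)
  next
    case (even k)
    show ?thesis
    proof (cases "even n")
      case True
      then obtain m where n: "n = 2 * m" by blast
      show ?thesis
        using coeff_step.even_even[of 1 a b k m y] assms by (simp add: n even)
    next
      case False
      then obtain m where n: "n = 2 * m + 1" using oddE by blast
      show ?thesis
        using coeff_step.odd_even[of 0 a b k m y] assms by (simp add: n even)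
    qed
  next
    case (odd k)
    show ?thesis
    proof (cases "even n")
      case True
      then obtain m where n: "n = 2 * m" by blast
      show ?thesis
        using coeff_step.even_odd[of 1 a b k m y] assms by (simp add: n odd)
    next
      case False
      then obtain m where n: "n = 2 * m + 1" using oddE by blast
      show ?thesis
        using coeff_step.odd_odd[of 0 a b k m y] assms by (simp add: n odd)
    qed
  qed
  then show "poly (smult (qint (int a) * q ^ b) (t_coeff n d)
     + smult (inverse (q ^ a) * qint (int b)) (q_shift (t_coeff n d))
     + (if d \<ge> 2 then smult (inverse (q ^ b)) (FE_correction (Suc a) * t_coeff n (d - 2)) else 0)
     + (if d \<ge> 1 then smult (inverse (q ^ (2 * a))) ([:0, 1:] * t_coeff n (d - 1)) else 0)) y
     = poly (smult (qint (int (n + 1))) (t_coeff (n + 1) d)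
     + (if even n \<and> d \<ge> 2 then smult (qint (int n)) (t_coeff (n - 1) (d - 2)) else 0)) y"
    unfolding A2 by (cases "d \<ge> 2"; cases "d \<ge> 1"; cases "even n") (simp_all add: poly_q_shift FE mult_ac)
qed

section \<open>Expansion of the divided powers\<close>

definition t_normal_coeff :: "nat \<Rightarrow> nat \<Rightarrow> nat \<Rightarrow> ratfun poly" where
  "t_normal_coeff n a b = smult (q powi (- (int a * int b))) (t_coeff n (n - a - b))"

text \<open>The factors \<open>q\<^bsup>b\<^esup>\<close>, \<open>q\<^bsup>-a\<^esup>\<close> and \<open>q\<^bsup>-b\<^esup>\<close> in \<open>t_coeff_recurrence\<close> are the changes of
\<open>q\<^bsup>-ab\<^esup>\<close> under the index shifts \<open>(a-1, b)\<close>, \<open>(a, b-1)\<close> and \<open>(a+1, b)\<close>, the second combined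
with the factor \<open>q\<^bsup>-2a\<^esup>\<close> of \<open>tt_normal_sum\<close>.\<close>
lemma t_normal_coeff_recurrence:
  assumes "a + b \<le> Suc n"
  shows "smult (qint (int a)) (t_normal_coeff n (a - 1) b)
     + smult (inverse (q ^ (2 * a)) * qint (int b)) (q_shift (t_normal_coeff n a (b - 1)))
     + (if a + b \<le> n then smult (inverse (q ^ (2 * a))) ([:0, 1:] * t_normal_coeff n a b) else 0)
     + (if a + b < n then FE_correction (Suc a) * t_normal_coeff n (Suc a) b else 0)
     = smult (qint (int (n + 1))) (t_normal_coeff (n + 1) a b)
     + (if a + b < n then smult (if even n then qint (int n) else 0) (t_normal_coeff (n - 1) a b) else 0)"
proof -
  define d where "d = n + 1 - a - b"
  define Q where "Q = q powi (- (int a * int b))"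
  have d: "a + b + d = n + 1" "n - a - b = d - 1" "n - Suc a - b = d - 2" "n - 1 - a - b = d - 2"
     "(a + b \<le> n) = (d \<ge> 1)" "(a + b < n) = (d \<ge> 2)"
    using assms by (auto simp: d_def)
  have d': "Suc n - (a + b) = d"
    by (simp add: d_def)
  have 1: "smult (qint (int a)) (t_normal_coeff n (a - 1) b) = smult Q (smult (qint (int a) * q ^ b) (t_coeff n d))"
  proof (cases a)
    case (Suc a')
    then have "n - a' - b = d" using d(1) by simp
    moreover have "q powi (- (int a' * int b)) = Q * q ^ b"
    proof -
      have "- (int a' * int b) = - (int a * int b) + int b" by (simp add: Suc algebra_simps)
      then show ?thesis unfolding Q_def using q_nonzero by (simp only: power_int_add power_int_of_nat simp_thms)
    qed
    ultimately show ?thesis by (simp add: t_normal_coeff_def Suc mult_ac)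
  qed (simp add: qint_def)
  have 2: "smult (inverse (q ^ (2 * a)) * qint (int b)) (q_shift (t_normal_coeff n a (b - 1)))
      = smult Q (smult (inverse (q ^ a) * qint (int b)) (q_shift (t_coeff n d)))"
  proof (cases b)
    case (Suc b')
    then have n: "n - a - b' = d" using d(1) by simp
    have "q powi (- (int a * int b')) = Q * q ^ a"
    proof -
      have "- (int a * int b') = - (int a * int b) + int a" by (simp add: Suc algebra_simps)
      then show ?thesis unfolding Q_def using q_nonzero by (simp only: power_int_add power_int_of_nat simp_thms)
    qed
    moreover have "inverse (q ^ (2 * a)) * q ^ a = inverse (q ^ a)"
      using q_nonzero by (simp add: mult_2 power_add)
    ultimately show ?thesis
      using n by (simp add: t_normal_coeff_def Suc q_shift_def pcompose_smult mult_ac)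
  qed (simp add: qint_def)
  have 3: "FE_correction (Suc a) * t_normal_coeff n (Suc a) b
     = smult Q (smult (inverse (q ^ b)) (FE_correction (Suc a) * t_coeff n (d - 2)))"
  proof -
    have "- (int (Suc a) * int b) = - (int a * int b) - int b" by (simp add: algebra_simps)
    then have "q powi (- (int (Suc a) * int b)) = Q * inverse (q ^ b)"
      unfolding Q_def using q_nonzero by (simp only: power_int_diff power_int_of_nat simp_thms divide_inverse)
    then show ?thesis by (simp only: t_normal_coeff_def d mult_smult_right smult_smult)
  qed
  show ?thesis
    using arg_cong[OF t_coeff_recurrence[OF d(1)], of "smult Q"]
    unfolding 1 2 3 unfolding t_normal_coeff_def d(2-)
    by (simp add: smult_add_right mult_ac add_ac d' flip: Q_def split: if_splits)
qed

lemma normal_sum_cong: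
  "(\<And>a b. a + b \<le> n \<Longrightarrow> f a b = g a b) \<Longrightarrow> normal_sum n f = normal_sum n g"
  unfolding normal_sum_def by (rule sum.cong) auto

lemma normal_sum_add: "normal_sum n (\<lambda>a b. f a b + g a b) = normal_sum n f + normal_sum n g"
  by (simp add: normal_sum_def normal_term_add split_def sum.distrib)

lemma normal_sum_smult: "normal_sum n (\<lambda>a b. smult c (f a b)) = c \<cdot> normal_sum n f"
  by (simp add: normal_sum_def normal_term_smult split_def uq.scale_sum_right)

lemma normal_sum_restrict:
  assumes "n > 0"
  shows "normal_sum (Suc n) (\<lambda>a b. if a + b < n then f a b else 0) = normal_sum (n - 1) f"
  unfolding normal_sum_def
  by (rule sum.mono_neutral_cong_right) (use assms in \<open>auto intro: finite_triangle split: if_splits\<close>)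

text \<open>The recurrence that determines the divided powers, established for the proposed expansion. At
\<open>n = 0\<close> the truncated \<open>n - 1\<close> does not matter because \<open>[0] = 0\<close>.\<close>
lemma tt_normal_sum_t_normal_coeff:
  "tt * normal_sum n (t_normal_coeff n) =
     qint (int (n + 1)) \<cdot> normal_sum (n + 1) (t_normal_coeff (n + 1))
     + (if even n then qint (int n) \<cdot> normal_sum (n - 1) (t_normal_coeff (n - 1)) else 0)"
proof -
  let ?c = "if even n then qint (int n) else 0"
  have "tt * normal_sum n (t_normal_coeff n) = normal_sum (Suc n) (\<lambda>a b.
      smult (qint (int (n + 1))) (t_normal_coeff (n + 1) a b)
      + (if a + b < n then smult ?c (t_normal_coeff (n - 1) a b) else 0))"
    unfolding tt_normal_sum by (rule normal_sum_cong) (rule t_normal_coeff_recurrence)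
  also have "\<dots> = qint (int (n + 1)) \<cdot> normal_sum (n + 1) (t_normal_coeff (n + 1))
      + normal_sum (Suc n) (\<lambda>a b. if a + b < n then smult ?c (t_normal_coeff (n - 1) a b) else 0)"
    by (simp only: normal_sum_add normal_sum_smult Suc_eq_plus1)
  also have "normal_sum (Suc n) (\<lambda>a b. if a + b < n then smult ?c (t_normal_coeff (n - 1) a b) else 0)
      = ?c \<cdot> normal_sum (n - 1) (t_normal_coeff (n - 1))"
  proof (cases "n = 0")
    case True
    then show ?thesis by (simp add: normal_sum_def qint_def split_def)
  next
    case False
    then show ?thesis by (simp only: normal_sum_restrict normal_sum_smult)
  qed
  finally show ?thesis by simp
qed

lemma t_odd_eq_normal_sum: "t_odd n = normal_sum n (t_normal_coeff n)"
proof (induction n rule: t_odd.induct)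
  case 1
  have "{(a, b). a + b \<le> (0 :: nat)} = {(0, 0)}" by auto
  then show ?case
    by (simp add: normal_sum_def t_normal_coeff_def t_coeff_0 normal_term_def Echeck_dp_def FF_dp_def qfact_def const_1)
next
  case 2
  have "{(a, b). a + b \<le> Suc 0} = {(0, 0), (0, 1), (1, 0)}" by auto
  moreover have "qint 1 = 1"
    using q_minus_inverse by (simp add: qint_def)
  ultimately show ?case
    using t_coeff_1[of 1]
    by (simp add: normal_sum_def t_normal_coeff_def t_coeff_0 normal_term_def Echeck_dp_def FF_dp_def
        qfact_def tt_def const_0 const_1)
next
  case (3 n)
  have IH: "t_odd (n + 1) = normal_sum (n + 1) (t_normal_coeff (n + 1))"
    "odd n \<Longrightarrow> t_odd n = normal_sum n (t_normal_coeff n)"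
    using 3 by (cases "even n"; simp)+
  have step: "(if even n then tt * t_odd (n + 1) else tt * t_odd (n + 1) - qint (int (n + 1)) \<cdot> t_odd n)
      = qint (int (n + 2)) \<cdot> normal_sum (n + 2) (t_normal_coeff (n + 2))"
    unfolding IH(1) tt_normal_sum_t_normal_coeff using IH(2) by simp
  have "t_odd (Suc (Suc n)) = (1 / qint (int (n + 2))) \<cdot> qint (int (n + 2)) \<cdot>
      normal_sum (n + 2) (t_normal_coeff (n + 2))"
    unfolding t_odd.simps(3) step ..
  then show ?case
    using qint_nonzero[of "n + 2"] by (simp del: t_odd.simps)
qed

lemma at_Kinv_brace_poly: "at_Kinv (brace_poly a k) = h_brace a k"
proof (induction k)
  case 0
  then show ?case by (simp add: h_brace_def)
next
  case (Suc k)
  let ?i = "Suc k"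
  let ?p = "smult (1 / (q ^ (4 * ?i) - 1)) (smult (q powi (4 * a + 4 * int ?i - 4)) ([:0, 1:] * [:0, 1:]) - [:q\<^sup>2:])"
  have "brace_poly a ?i = brace_poly a k * ?p"
    by (simp add: brace_poly_def power2_eq_square mult.commute)
  then have "at_Kinv (brace_poly a ?i) = h_brace a k * at_Kinv ?p"
    by (simp only: at_Kinv_mult Suc.IH)
  also have "\<dots> = h_brace a k *
      ((1 / (q ^ (4 * ?i) - 1)) \<cdot> (q powi (4 * a + 4 * int ?i - 4) \<cdot> Kinv\<^sup>2 - const (q\<^sup>2)))"
    by (simp only: at_Kinv_smult at_Kinv_diff at_Kinv_mult at_Kinv_X at_Kinv_const power2_eq_square)
  also have "\<dots> = h_brace a ?i"
    by (simp add: h_brace_def)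
  finally show ?case .
qed

text \<open>The sums in the theorem run over \<open>a\<close> and over \<open>c\<close>, that is, over the deficit separated by parity.\<close>
lemma normal_sum_by_deficit:
  "normal_sum n g = (\<Sum>d = 0..n. \<Sum>a = 0..n - d. normal_term a (g a (n - d - a)) (n - d - a))"
proof -
  have "normal_sum n g = (\<Sum>(d, a) \<in> (SIGMA d:{0..n}. {0..n - d}). normal_term a (g a (n - d - a)) (n - d - a))"
    unfolding normal_sum_def
    by (rule sum.reindex_bij_witness[where j = "\<lambda>(a, b). (n - a - b, a)" and i = "\<lambda>(d, a). (a, n - d - a)"])
      auto
  then show ?thesis
    by (simp add: sum.Sigma)
qed

lemma sum_split_parity:
  fixes f :: "nat \<Rightarrow> 'a :: comm_monoid_add"
  shows "(\<Sum>d = 0..2 * m. f d) = (\<Sum>c = 0..m. f (2 * c)) + (\<Sum>c = 0..<m. f (2 * c + 1))"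
    and "(\<Sum>d = 0..2 * m + 1. f d) = (\<Sum>c = 0..m. f (2 * c)) + (\<Sum>c = 0..m. f (2 * c + 1))"
proof -
  show 1: "(\<Sum>d = 0..2 * m. f d) = (\<Sum>c = 0..m. f (2 * c)) + (\<Sum>c = 0..<m. f (2 * c + 1))"
    by (induction m) (simp_all add: ac_simps)
  show "(\<Sum>d = 0..2 * m + 1. f d) = (\<Sum>c = 0..m. f (2 * c)) + (\<Sum>c = 0..m. f (2 * c + 1))"
    using 1 by (simp add: ac_simps atLeast0LessThan lessThan_Suc_atMost[symmetric] atLeast0AtMost del: sum.op_ivl_Suc)
qed

lemma normal_term_of_t_coeff:
  assumes "t_coeff n d = smult (q powi e) p" "at_Kinv p = h" "a + d \<le> n" "b = n - d - a"
    and "e' = e - int a * (int n - int d - int a)"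
  shows "normal_term a (t_normal_coeff n a b) b = q powi e' \<cdot> (Echeck_dp a * h * FF_dp b)"
proof -
  have "n - a - b = d"
    using assms by simp
  moreover have "q powi e' = q powi (- (int a * int b)) * q powi e"
  proof -
    have "e' = - (int a * int b) + e"
      using assms by (simp add: of_nat_diff)
    then show ?thesis
      using q_nonzero by (simp only: power_int_add simp_thms)
  qed
  ultimately show ?thesis
    by (simp only: t_normal_coeff_def assms(1) smult_smult normal_term_smult) (simp only: normal_term_def assms(2))
qed

lemma at_Kinv_brace_poly_X: "at_Kinv (brace_poly a k * [:0, 1:]) = h_brace a k * Kinv"
  by (simp only: at_Kinv_mult at_Kinv_brace_poly at_Kinv_X)

theorem theorem5p1:
  fixes m :: nat
  shows
    "t_odd (2 * m) =
       (\<Sum>c = 0..m. \<Sum>a = 0..2 * m - 2 * c.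
          q powi (choose2 (2 * int c - 1) - 1 - int a * (2 * int m - 2 * int c - int a)) \<cdot>
            (Echeck_dp a * h_brace (2 - int m) c * FF_dp (2 * m - 2 * c - a)))
       + (\<Sum>c = 0..<m. \<Sum>a = 0..2 * m - 1 - 2 * c.
          q powi (choose2 (2 * int c) + 1 - 2 * int m
                   - int a * (2 * int m - 1 - 2 * int c - int a)) \<cdot>
            (Echeck_dp a * h_brace (2 - int m) c * Kinv * FF_dp (2 * m - 1 - 2 * c - a)))
     \<and>
     t_odd (2 * m + 1) =
       (\<Sum>c = 0..m. \<Sum>a = 0..2 * m + 1 - 2 * c.
          q powi (choose2 (2 * int c) - int a * (2 * int m + 1 - 2 * int c - int a)) \<cdot>
            (Echeck_dp a * h_brace (1 - int m) c * FF_dp (2 * m + 1 - 2 * c - a)))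
       + (\<Sum>c = 0..m. \<Sum>a = 0..2 * m - 2 * c.
          q powi (choose2 (2 * int c + 1) - 2 * int m
                   - int a * (2 * int m - 2 * int c - int a)) \<cdot>
            (Echeck_dp a * h_brace (1 - int m) c * Kinv * FF_dp (2 * m - 2 * c - a)))"
proof
  show "t_odd (2 * m) =
       (\<Sum>c = 0..m. \<Sum>a = 0..2 * m - 2 * c.
          q powi (choose2 (2 * int c - 1) - 1 - int a * (2 * int m - 2 * int c - int a)) \<cdot>
            (Echeck_dp a * h_brace (2 - int m) c * FF_dp (2 * m - 2 * c - a)))
       + (\<Sum>c = 0..<m. \<Sum>a = 0..2 * m - 1 - 2 * c.
          q powi (choose2 (2 * int c) + 1 - 2 * int m
                   - int a * (2 * int m - 1 - 2 * int c - int a)) \<cdot>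
            (Echeck_dp a * h_brace (2 - int m) c * Kinv * FF_dp (2 * m - 1 - 2 * c - a)))"
    (is "_ = (\<Sum>c = 0..m. sum (?f c) _) + (\<Sum>c = 0..<m. sum (?g c) _)")
  proof -
    have f: "normal_term a (t_normal_coeff (2 * m) a (2 * m - 2 * c - a)) (2 * m - 2 * c - a) = ?f c a"
      if "c \<le> m" "a \<le> 2 * m - 2 * c" for c a
      by (rule normal_term_of_t_coeff[OF t_coeff_even_even at_Kinv_brace_poly])
        (use that in simp_all)
    have g: "normal_term a (t_normal_coeff (2 * m) a (2 * m - (2 * c + 1) - a)) (2 * m - (2 * c + 1) - a) = ?g c a"
      if "c < m" "a \<le> 2 * m - (2 * c + 1)" for c a
      using normal_term_of_t_coeff[OF t_coeff_even_odd at_Kinv_brace_poly_X, OF _ refl refl, of a c m] that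
      by (simp add: mult.assoc diff_diff_add)
    show ?thesis
      unfolding t_odd_eq_normal_sum normal_sum_by_deficit sum_split_parity
    proof (intro arg_cong2[where f = "(+)"] sum.cong refl)
      fix c a assume "c \<in> {0..m}" "a \<in> {0..2 * m - 2 * c}"
      then show "normal_term a (t_normal_coeff (2 * m) a (2 * m - 2 * c - a)) (2 * m - 2 * c - a) = ?f c a"
        using f by simp
    next
      fix c a assume "c \<in> {0..<m}" "a \<in> {0..2 * m - 1 - 2 * c}"
      then show "normal_term a (t_normal_coeff (2 * m) a (2 * m - (2 * c + 1) - a)) (2 * m - (2 * c + 1) - a) = ?g c a"
        using g by simp
    qed simp
  qed
next
  show "t_odd (2 * m + 1) =
       (\<Sum>c = 0..m. \<Sum>a = 0..2 * m + 1 - 2 * c.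
          q powi (choose2 (2 * int c) - int a * (2 * int m + 1 - 2 * int c - int a)) \<cdot>
            (Echeck_dp a * h_brace (1 - int m) c * FF_dp (2 * m + 1 - 2 * c - a)))
       + (\<Sum>c = 0..m. \<Sum>a = 0..2 * m - 2 * c.
          q powi (choose2 (2 * int c + 1) - 2 * int m
                   - int a * (2 * int m - 2 * int c - int a)) \<cdot>
            (Echeck_dp a * h_brace (1 - int m) c * Kinv * FF_dp (2 * m - 2 * c - a)))"
    (is "_ = (\<Sum>c = 0..m. sum (?f c) _) + (\<Sum>c = 0..m. sum (?g c) _)")
  proof -
    have f: "normal_term a (t_normal_coeff (2 * m + 1) a (2 * m + 1 - 2 * c - a)) (2 * m + 1 - 2 * c - a) = ?f c a"
      if "c \<le> m" "a \<le> 2 * m + 1 - 2 * c" for c a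
      by (rule normal_term_of_t_coeff[OF t_coeff_odd_even at_Kinv_brace_poly])
        (use that in simp_all)
    have g: "normal_term a (t_normal_coeff (2 * m + 1) a (2 * m + 1 - (2 * c + 1) - a)) (2 * m + 1 - (2 * c + 1) - a) = ?g c a"
      if "c \<le> m" "a \<le> 2 * m + 1 - (2 * c + 1)" for c a
      using normal_term_of_t_coeff[OF t_coeff_odd_odd at_Kinv_brace_poly_X, OF _ refl refl, of a c m] that
      by (simp add: mult.assoc diff_diff_add)
    show ?thesis
      unfolding t_odd_eq_normal_sum normal_sum_by_deficit sum_split_parity
    proof (intro arg_cong2[where f = "(+)"] sum.cong refl)
      fix c a assume "c \<in> {0..m}" "a \<in> {0..2 * m + 1 - 2 * c}"
      then show "normal_term a (t_normal_coeff (2 * m + 1) a (2 * m + 1 - 2 * c - a)) (2 * m + 1 - 2 * c - a) = ?f c a"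
        using f by simp
    next
      fix c a assume "c \<in> {0..m}" "a \<in> {0..2 * m - 2 * c}"
      then show "normal_term a (t_normal_coeff (2 * m + 1) a (2 * m + 1 - (2 * c + 1) - a)) (2 * m + 1 - (2 * c + 1) - a) = ?g c a"
        using g by simp
    qed simp
  qed
qed

end
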